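(* For all $\gamma > 0$ and $\Delta \in \mathbb{N}$ (with $\Delta\ge 1$), there is a constant $C > 0$ such that the following holds. If $H$ is an $n$-vertex graph with maximum degree $\Delta(H) \leq \Delta$ and $G$ is an $n$-vertex graph with minimum degree $\delta(G) \geq \bigl( \frac{2\Delta-1}{2\Delta}+ \gamma\bigr) n$, then for $p\in[0,1]$ with $p \geq C n^{-1/m_1(H)}\log n$, with high probability (as $n\to\infty$), the graph $H$ is a subgraph of the random graph $G(p)$ (i.e. $G(p)$ contains a spanning copy of $H$).
   Context: All graphs are simple and finite. For a graph $G$ and $p\in[0,1]$, $G(p)$ is the random subgraph of $G$ on $V(G)$ obtained by retaining each edge of $G$ independently with probability $p$. For a graph $F$ with at least two vertices let $d_1(F)=e(F)/(v(F)-1)$, where $e(F)$, $v(F)$ are the numbers of edges and vertices; the maximum $1$-density of $H$ is $m_1(H)=\max_{H'\subseteq H} d_1(H')$, the maximum being over all subgraphs $H'$ of $H$ with at least two vertices. If $H$ has no edges (so $m_1(H)=0$), the expression $n^{-1/m_1(H)}$ is read as $0$. "With high probability" means with probability tending to $1$ as $n\to\infty$; formally the statement concerns sequences $H=(H_n)$, $G=(G_n)$, $p=(p_n)$, where for each $n$ the $n$-vertex graphs $H_n,G_n$ and $p_n$ satisfy the stated conditions, and the constant $C$ depends only on $\gamma$ and $\Delta$. *)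

theory Defs
  imports "HOL-Probability.Probability"
begin

datatype 'a graph = Graph (verts: "'a set") (edges: "'a set set")

definition simple_graph :: "'a graph \<Rightarrow> bool" where
  "simple_graph G \<longleftrightarrow> finite (verts G) \<and> (\<forall>e\<in>edges G. e \<subseteq> verts G \<and> card e = 2)"

definition degree :: "'a graph \<Rightarrow> 'a \<Rightarrow> nat" where
  "degree G v = card {e \<in> edges G. v \<in> e}"

(* The extremal degrees are meaningful only for graphs with at least one vertex. *)
definition max_degree :: "'a graph \<Rightarrow> nat" where
  "max_degree G = Max (degree G ` verts G)"

definition min_degree :: "'a graph \<Rightarrow> nat" where
  "min_degree G = Min (degree G ` verts G)"

definition subgraph :: "'a graph \<Rightarrow> 'a graph \<Rightarrow> bool" where
  "subgraph F H \<longleftrightarrow> simple_graph F \<and> verts F \<subseteq> verts H \<and> edges F \<subseteq> edges H"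

definition d1 :: "'a graph \<Rightarrow> real" where
  "d1 F = real (card (edges F)) / (real (card (verts F)) - 1)"

(* Meaningful only for graphs with at least two vertices. *)
definition m1 :: "'a graph \<Rightarrow> real" where
  "m1 H = Max {d1 F |F. subgraph F H \<and> card (verts F) \<ge> 2}"

(* The expression n^(-1/m1(H)), read as 0 if H has no edges. The case distinction is
   needed because division by zero would otherwise turn that value into n^0 = 1. *)
definition m1_power :: "nat \<Rightarrow> 'a graph \<Rightarrow> real" where
  "m1_power n H = (if edges H = {} then 0 else real n powr (- 1 / m1 H))"

(* G(p): one independent Bernoulli(p) coin per edge; the edges whose coin shows True stay. *)
definition random_subgraph :: "'a graph \<Rightarrow> real \<Rightarrow> 'a graph pmf" where
  "random_subgraph G p =
     map_pmf (\<lambda>keep. Graph (verts G) {e \<in> edges G. keep e})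
       (Pi_pmf (edges G) False (\<lambda>_. bernoulli_pmf p))"

(* K has a subgraph isomorphic to H; such a copy is spanning when the vertex sets of H and K
   have the same size. *)
definition contains_copy :: "'a graph \<Rightarrow> 'b graph \<Rightarrow> bool" where
  "contains_copy K H \<longleftrightarrow>
     (\<exists>\<phi>. inj_on \<phi> (verts H) \<and> \<phi> ` verts H \<subseteq> verts K \<and> (\<forall>e\<in>edges H. \<phi> ` e \<in> edges K))"

end

theory Submission
  imports Defs "HOL-Real_Asymp.Real_Asymp"
begin

text \<open>
  The argument has two halves: a uniformly random embedding of \<open>H\<close> into \<open>G\<close> is well spread, and a
  well spread family of edge sets is hit by a sparse random edge set.

  Let \<open>n\<close> be the number of vertices and \<open>c = 2 \<Delta> \<gamma>\<close>. Every vertex of \<open>G\<close> has at most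
  \<open>b = (1 / (2 \<Delta>) - \<gamma>) n\<close> non-neighbours (counting itself). As in the Sauer--Spencer packing theorem,
  for any bijection \<open>\<phi>\<close> between the vertex sets and any vertex \<open>x\<close> of \<open>H\<close>, exchanging the images of \<open>x\<close>
  and \<open>x'\<close> puts all edges of \<open>H\<close> at \<open>x\<close> or \<open>x'\<close> onto edges of \<open>G\<close>, for all but \<open>2 \<Delta> b\<close> choices of
  \<open>x'\<close>, that is for at least \<open>c n\<close> of them (\<open>card_good_partners\<close>). Hence a bijection with the fewest
  badly placed edges is an embedding, and the nonempty set \<open>E\<close> of all embeddings is rich in swaps:
  each \<open>\<phi> \<in> E\<close> and each \<open>x\<close> admit \<open>c n\<close> vertices \<open>x'\<close> whose swap with \<open>x\<close> stays in \<open>E\<close>.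

  Being rich in swaps forces \<open>P(\<Phi> = y on S) \<le> (D / n)^|S|\<close> for uniform \<open>\<Phi> \<in> E\<close> and all \<open>S\<close> and \<open>y\<close>
  (\<open>many_swaps_imp_vertex_spread\<close>). For \<open>|S| \<le> c n / 2\<close> one frees the vertices of \<open>S\<close> one at a time
  by swapping them with vertices outside \<open>S\<close>. For larger \<open>S\<close> at most \<open>n^(n - |S|)\<close> embeddings agree with
  \<open>y\<close> on \<open>S\<close>, so that it suffices to have \<open>|E| \<ge> c^n n!\<close> (\<open>card_ge_of_many_swaps\<close>). This lower bound
  is an entropy estimate: reveal \<open>\<Phi>\<close> vertex by vertex in a uniformly random order. When a set \<open>Q\<close> of \<open>m\<close>
  vertices is still hidden, the conditional entropy of the next value is at least the expected logarithm
  of the number of swap partners inside \<open>Q\<close>; as \<open>Q\<close> is a random set, this is at least \<open>ln (c m)\<close>.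

  Summing over the at most \<open>n \<Delta>^(v - 1)\<close> positions in \<open>H\<close> of each connected component with \<open>v\<close> vertices
  turns vertex spread into edge spread (\<open>vertex_spread_imp_spread\<close>): every set \<open>U\<close> of edges of \<open>G\<close>
  lies in the image of \<open>H\<close> with probability at most \<open>q^|U|\<close>, where \<open>q\<close> is a constant times
  \<open>n^(-1 / m\<^sub>1(H))\<close>. The density enters through \<open>e \<le> m\<^sub>1(H) (v - 1)\<close> for a component with \<open>e\<close> edges.

  Finally, if a family of sets of size at most \<open>2^k\<close> carries a \<open>q\<close>-spread distribution, then a random
  set of density \<open>256 (3 k + 1) q\<close> contains one of them except with probability \<open>1 / sqrt (1 + k)\<close>
  (\<open>spread_imp_likely\<close>). This is the fractional expectation-threshold theorem, proved by the minimum
  fragment method of Park and Pham: spread families admit no cheap cover, whereas each failure of the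
  random set produces a cover that is cheap on average. With \<open>k\<close> about \<open>log 2 (\<Delta> n)\<close> the theorem follows.
\<close>

section \<open>Random subsets and spread families\<close>

text \<open>
  The expectation of \<open>f W\<close> for a random subset \<open>W\<close> of the finite set \<open>X\<close> that contains each element
  independently with probability \<open>p\<close>, written out as a sum over all subsets.
\<close>

definition binexp :: "'a set \<Rightarrow> real \<Rightarrow> ('a set \<Rightarrow> real) \<Rightarrow> real" where
  "binexp X p f = (\<Sum>W\<in>Pow X. p ^ card W * (1 - p) ^ card (X - W) * f W)"

lemma binexp_empty [simp]: "binexp {} p f = f {}"
  by (simp add: binexp_def)

lemma binexp_insert:
  assumes "finite X" "x \<notin> X"
  shows "binexp (insert x X) p f = p * binexp X p (\<lambda>W. f (insert x W)) + (1 - p) * binexp X p f"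
proof -
  have inj: "inj_on (insert x) (Pow X)"
    using assms(2) by (auto simp: inj_on_def)
  have fin: "finite W" if "W \<in> Pow X" for W
    using that assms(1) finite_subset by auto
  have "binexp (insert x X) p f
      = (\<Sum>W\<in>Pow X. p ^ card W * (1 - p) ^ card (insert x X - W) * f W)
        + (\<Sum>W\<in>insert x ` Pow X. p ^ card W * (1 - p) ^ card (insert x X - W) * f W)"
    unfolding binexp_def Pow_insert using assms by (subst sum.union_disjoint) auto
  also have "(\<Sum>W\<in>Pow X. p ^ card W * (1 - p) ^ card (insert x X - W) * f W) = (1 - p) * binexp X p f"
    unfolding binexp_def sum_distrib_left
  proof (rule sum.cong[OF refl])
    fix W assume W: "W \<in> Pow X"
    then have "insert x X - W = insert x (X - W)" using assms(2) by auto
    then have "card (insert x X - W) = Suc (card (X - W))" using assms by simp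
    then show "p ^ card W * (1 - p) ^ card (insert x X - W) * f W
        = (1 - p) * (p ^ card W * (1 - p) ^ card (X - W) * f W)" by simp
  qed
  also have "(\<Sum>W\<in>insert x ` Pow X. p ^ card W * (1 - p) ^ card (insert x X - W) * f W)
      = p * binexp X p (\<lambda>W. f (insert x W))"
    unfolding binexp_def sum_distrib_left sum.reindex[OF inj] o_def
  proof (rule sum.cong[OF refl])
    fix W assume W: "W \<in> Pow X"
    then have "x \<notin> W" using assms(2) by auto
    moreover from this have "insert x X - insert x W = X - W" using assms(2) by auto
    ultimately show "p ^ card (insert x W) * (1 - p) ^ card (insert x X - insert x W) * f (insert x W)
        = p * (p ^ card W * (1 - p) ^ card (X - W) * f (insert x W))"
      using fin[OF W] by simp
  qed
  finally show ?thesis by simp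
qed

lemma binexp_const: "finite X \<Longrightarrow> binexp X p (\<lambda>_. c) = c"
  by (induction X rule: finite_induct) (simp_all add: binexp_insert algebra_simps)

lemma binexp_add: "binexp X p (\<lambda>W. f W + g W) = binexp X p f + binexp X p g"
  by (simp add: binexp_def algebra_simps sum.distrib)

lemma binexp_cmult: "binexp X p (\<lambda>W. c * f W) = c * binexp X p f"
  by (simp add: binexp_def algebra_simps sum_distrib_left)

lemma binexp_mono:
  assumes "0 \<le> p" "p \<le> 1" "\<And>W. W \<subseteq> X \<Longrightarrow> f W \<le> g W"
  shows "binexp X p f \<le> binexp X p g"
  unfolding binexp_def using assms by (intro sum_mono mult_left_mono) auto

text \<open>
  The union of independent random subsets of densities \<open>p\<close> and \<open>r\<close> is a random subset of density
  \<open>p + r - p * r\<close>.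
\<close>

lemma binexp_union:
  assumes "finite X"
  shows "binexp X p (\<lambda>W. binexp X r (\<lambda>W'. f (W \<union> W'))) = binexp X (p + r - p * r) f"
  using assms
proof (induction X arbitrary: f rule: finite_induct)
  case (insert x X)
  have "binexp (insert x X) p (\<lambda>W. binexp (insert x X) r (\<lambda>W'. f (W \<union> W')))
    = p * binexp X p (\<lambda>W. r * binexp X r (\<lambda>W'. f (insert x (W \<union> W')))
          + (1 - r) * binexp X r (\<lambda>W'. f (insert x (W \<union> W'))))
     + (1 - p) * binexp X p (\<lambda>W. r * binexp X r (\<lambda>W'. f (insert x (W \<union> W')))
          + (1 - r) * binexp X r (\<lambda>W'. f (W \<union> W')))"
    using insert.hyps by (simp add: binexp_insert)
  also have "\<dots> = (p + r - p * r) * binexp X p (\<lambda>W. binexp X r (\<lambda>W'. f (insert x (W \<union> W'))))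
     + (1 - (p + r - p * r)) * binexp X p (\<lambda>W. binexp X r (\<lambda>W'. f (W \<union> W')))"
    unfolding binexp_add binexp_cmult by algebra
  also have "\<dots> = binexp (insert x X) (p + r - p * r) f"
    using insert.IH[of "\<lambda>W. f (insert x W)"] insert.IH[of f] insert.hyps by (simp add: binexp_insert)
  finally show ?case .
qed simp

lemma binexp_decreasing:
  assumes "finite X" "0 \<le> p" "p \<le> r" "r \<le> 1"
    and "\<And>A B. A \<subseteq> B \<Longrightarrow> f B \<le> f A"
  shows "binexp X r f \<le> binexp X p f"
  using assms(1,5)
proof (induction X arbitrary: f rule: finite_induct)
  case (insert x X)
  let ?g = "\<lambda>W. f (insert x W)"
  have 1: "binexp X r ?g \<le> binexp X p ?g" by (intro insert.IH insert.prems) auto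
  have 2: "binexp X r f \<le> binexp X p f" by (intro insert.IH insert.prems)
  have 3: "binexp X p ?g \<le> binexp X p f"
    by (rule binexp_mono) (use assms in \<open>auto intro!: insert.prems\<close>)
  have "r * binexp X r ?g + (1 - r) * binexp X r f \<le> r * binexp X p ?g + (1 - r) * binexp X p f"
    using 1 2 assms by (intro add_mono mult_left_mono) auto
  also have "\<dots> = p * binexp X p ?g + (1 - p) * binexp X p f
      + (r - p) * (binexp X p ?g - binexp X p f)" by algebra
  also have "\<dots> \<le> p * binexp X p ?g + (1 - p) * binexp X p f"
    using 3 assms by (simp add: mult_nonneg_nonpos)
  finally show ?case using insert.hyps by (simp add: binexp_insert)
qed simp

text \<open>
  The probability that the random subset of density \<open>p\<close> contains no member of the family \<open>\<H>\<close>.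
\<close>

definition fail_prob :: "'a set \<Rightarrow> real \<Rightarrow> 'a set set \<Rightarrow> real" where
  "fail_prob X p \<H> = binexp X p (\<lambda>W. if \<exists>S\<in>\<H>. S \<subseteq> W then 0 else 1)"

lemma fail_prob_nonneg: "0 \<le> p \<Longrightarrow> p \<le> 1 \<Longrightarrow> 0 \<le> fail_prob X p \<H>"
  unfolding fail_prob_def binexp_def by (intro sum_nonneg) auto

lemma fail_prob_le_1: "finite X \<Longrightarrow> 0 \<le> p \<Longrightarrow> p \<le> 1 \<Longrightarrow> fail_prob X p \<H> \<le> 1"
  using binexp_mono[of p X "\<lambda>W. if \<exists>S\<in>\<H>. S \<subseteq> W then 0 else 1" "\<lambda>_. 1"]
  by (simp add: fail_prob_def binexp_const)

text \<open>
  A cover of \<open>\<H>\<close> is a family \<open>\<U>\<close> of subsets of \<open>X\<close> such that each member of \<open>\<H>\<close> includes a member of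
  \<open>\<U>\<close>. Its cost at \<open>q\<close> is the expected number of members of \<open>\<U>\<close> inside a random subset of density \<open>q\<close>.
\<close>

definition covers :: "'a set \<Rightarrow> 'a set set \<Rightarrow> 'a set set set" where
  "covers X \<H> = {\<U>. \<U> \<subseteq> Pow X \<and> (\<forall>S\<in>\<H>. \<exists>U\<in>\<U>. U \<subseteq> S)}"

definition cost :: "real \<Rightarrow> 'a set set \<Rightarrow> real" where
  "cost q \<U> = (\<Sum>U\<in>\<U>. q ^ card U)"

text \<open>
  The least cost of a cover. Covers exist if \<open>\<H>\<close> consists of subsets of \<open>X\<close>, as \<open>\<H>\<close> covers itself.
\<close>

definition min_cost :: "real \<Rightarrow> 'a set \<Rightarrow> 'a set set \<Rightarrow> real" where
  "min_cost q X \<H> = Min (cost q ` covers X \<H>)"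

lemma finite_covers: "finite X \<Longrightarrow> finite (covers X \<H>)"
  by (rule finite_subset[of _ "Pow (Pow X)"]) (auto simp: covers_def)

lemma min_cost_le: "finite X \<Longrightarrow> \<U> \<in> covers X \<H> \<Longrightarrow> min_cost q X \<H> \<le> cost q \<U>"
  unfolding min_cost_def by (intro Min_le) (auto simp: finite_covers)

lemma min_cost_attained:
  assumes "finite X" "\<H> \<subseteq> Pow X"
  obtains \<U> where "\<U> \<in> covers X \<H>" "cost q \<U> = min_cost q X \<H>"
proof -
  have "\<H> \<in> covers X \<H>" using assms(2) by (auto simp: covers_def)
  then have "min_cost q X \<H> \<in> cost q ` covers X \<H>"
    unfolding min_cost_def using assms(1) by (intro Min_in) (auto simp: finite_covers)
  then show ?thesis using that by auto
qed

lemma min_cost_nonneg: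
  assumes "finite X" "\<H> \<subseteq> Pow X" "0 \<le> q"
  shows "0 \<le> min_cost q X \<H>"
proof -
  obtain \<U> where "\<U> \<in> covers X \<H>" "cost q \<U> = min_cost q X \<H>"
    using min_cost_attained[OF assms(1,2)] .
  moreover have "0 \<le> cost q \<U>" unfolding cost_def using assms(3) by (intro sum_nonneg) simp
  ultimately show ?thesis by simp
qed

lemma cost_Un_le:
  assumes "finite \<U>" "finite \<V>" "0 \<le> q"
  shows "cost q (\<U> \<union> \<V>) \<le> cost q \<U> + cost q \<V>"
  using assms by (simp add: cost_def sum_Un sum_nonneg)

text \<open>
  For \<open>S \<in> \<H>\<close> and a random set \<open>W\<close>, the fragments are the sets still missing from \<open>W\<close> in order to
  contain some member of \<open>\<H>\<close> that lies within \<open>S \<union> W\<close>. They are subsets of \<open>S\<close>; the minimum fragment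
  is one of least size.
\<close>

definition fragments :: "'a set set \<Rightarrow> 'a set \<Rightarrow> 'a set \<Rightarrow> 'a set set" where
  "fragments \<H> W S = {S' - W |S'. S' \<in> \<H> \<and> S' \<subseteq> S \<union> W}"

definition min_fragment :: "'a set set \<Rightarrow> 'a set \<Rightarrow> 'a set \<Rightarrow> 'a set" where
  "min_fragment \<H> W S = arg_min card (\<lambda>T. T \<in> fragments \<H> W S)"

lemma min_fragment_in:
  assumes "S \<in> \<H>"
  shows "min_fragment \<H> W S \<in> fragments \<H> W S"
  unfolding min_fragment_def
proof (rule arg_min_natI)
  show "S - W \<in> fragments \<H> W S" using assms by (auto simp: fragments_def)
qed

lemma min_fragment_le:
  assumes "T \<in> fragments \<H> W S"
  shows "card (min_fragment \<H> W S) \<le> card T"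
  unfolding min_fragment_def using assms by (rule arg_min_nat_le)

text \<open>
  The minimum fragments of more than half the size bound \<open>l\<close> form a family of small expected cost.
  Encode a pair of \<open>W\<close> and a minimum fragment \<open>U\<close> by \<open>Z = W \<union> U\<close> and \<open>U\<close>. By minimality, \<open>U\<close> lies in
  any member of \<open>\<H>\<close> that is contained in \<open>Z\<close>, so that given \<open>Z\<close> there are at most \<open>2^l\<close> choices for
  \<open>U\<close>; and the weight of \<open>W\<close> times \<open>q^|U|\<close> is at most the weight of \<open>Z\<close> times \<open>L^(-|U|)\<close>.
\<close>

lemma large_fragments_expected_cost:
  fixes L q :: real
  assumes X: "finite X" and \<H>: "\<H> \<subseteq> Pow X" "\<And>S. S \<in> \<H> \<Longrightarrow> card S \<le> l"
    and q: "0 < q" "1 \<le> L" "L * q \<le> 1"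
  shows "binexp X (L * q) (\<lambda>W. cost q {T \<in> min_fragment \<H> W ` \<H>. l < 2 * card T})
    \<le> (2 / sqrt L) ^ l"
proof -
  define r where "r = L * q"
  define \<U> where "\<U> W = {T \<in> min_fragment \<H> W ` \<H>. l < 2 * card T}" for W
  define pick where "pick Z = (SOME S. S \<in> \<H> \<and> S \<subseteq> Z)" for Z
  define A where "A = Sigma (Pow X) \<U>"
  define B where "B = Sigma {Z \<in> Pow X. \<exists>S\<in>\<H>. S \<subseteq> Z} (\<lambda>Z. {U. U \<subseteq> pick Z \<and> l < 2 * card U})"
  have pick: "pick Z \<in> \<H> \<and> pick Z \<subseteq> Z" if "\<exists>S\<in>\<H>. S \<subseteq> Z" for Z
    unfolding pick_def using that by (metis (mono_tags, lifting) someI)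
  have r: "0 < r" "r \<le> 1" using q by (auto simp: r_def)
  have fin\<H>: "finite S" if "S \<in> \<H>" for S using that \<H>(1) X finite_subset by blast
  have fin\<U>: "finite (\<U> W)" for W
  proof -
    have "finite \<H>" using \<H>(1) X by (meson finite_Pow_iff finite_subset)
    then show ?thesis by (auto simp: \<U>_def)
  qed
  have finB: "finite B" unfolding B_def
  proof (rule finite_SigmaI)
    show "finite {Z \<in> Pow X. \<exists>S\<in>\<H>. S \<subseteq> Z}" using X by simp
    fix Z assume "Z \<in> {Z \<in> Pow X. \<exists>S\<in>\<H>. S \<subseteq> Z}"
    then have "finite (pick Z)" using pick fin\<H> by blast
    then show "finite {U. U \<subseteq> pick Z \<and> l < 2 * card U}" by simp
  qed
  \<comment> \<open>The encoding of \<open>(W, U)\<close> is injective, and the second component is confined to \<open>pick Z\<close>.\<close>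
  have key: "U \<subseteq> X \<and> U \<inter> W = {} \<and> (\<exists>S\<in>\<H>. S \<subseteq> W \<union> U) \<and> U \<subseteq> pick (W \<union> U)"
    if U: "U \<in> \<U> W" "W \<subseteq> X" for U W
  proof -
    obtain S where S: "S \<in> \<H>" "U = min_fragment \<H> W S" using U unfolding \<U>_def by blast
    obtain S' where S': "S' \<in> \<H>" "S' \<subseteq> S \<union> W" "U = S' - W"
      using min_fragment_in[OF S(1), of W] S(2) by (auto simp: fragments_def)
    have ex: "\<exists>S\<in>\<H>. S \<subseteq> W \<union> U" using S' by blast
    define P where "P = pick (W \<union> U)"
    have P: "P \<in> \<H>" "P \<subseteq> W \<union> U" using pick[OF ex] by (auto simp: P_def)
    have "P - W \<in> fragments \<H> W S" using P S' by (auto simp: fragments_def)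
    then have "card U \<le> card (P - W)" using min_fragment_le S(2) by blast
    moreover have "P - W \<subseteq> U" using P by blast
    moreover have "finite U" using S' fin\<H> by blast
    ultimately have "P - W = U" by (meson card_seteq)
    then show ?thesis using ex S' \<H>(1) by (auto simp: P_def)
  qed
  have "binexp X r (\<lambda>W. cost q (\<U> W))
      = (\<Sum>W\<in>Pow X. \<Sum>U\<in>\<U> W. r ^ card W * (1 - r) ^ card (X - W) * q ^ card U)"
    by (simp add: binexp_def cost_def sum_distrib_left)
  also have "\<dots> = (\<Sum>(W, U)\<in>A. r ^ card W * (1 - r) ^ card (X - W) * q ^ card U)"
    unfolding A_def using X fin\<U> by (subst sum.Sigma) auto
  also have "\<dots> \<le> (\<Sum>(W, U)\<in>A. r ^ card (W \<union> U) * (1 - r) ^ card (X - (W \<union> U)) * (1 / L) ^ card U)"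
  proof (rule sum_mono, clarify)
    fix W U assume "(W, U) \<in> A"
    then have U: "U \<in> \<U> W" and W: "W \<subseteq> X" by (auto simp: A_def)
    note k = key[OF U W]
    have fW: "finite W" and fU: "finite U" using W k X finite_subset by auto
    have c1: "card (W \<union> U) = card W + card U" using k fW fU by (subst card_Un_disjoint) auto
    have "X - W = (X - (W \<union> U)) \<union> U" using k by auto
    moreover have "card ((X - (W \<union> U)) \<union> U) = card (X - (W \<union> U)) + card U"
      using X fU by (intro card_Un_disjoint) auto
    ultimately have c2: "card (X - W) = card (X - (W \<union> U)) + card U" by metis
    have "(1 - r) ^ card U * q ^ card U \<le> 1 * q ^ card U"
      using r q by (intro mult_right_mono power_le_one) auto
    also have "\<dots> = r ^ card U * (1 / L) ^ card U"
      using q by (simp add: r_def power_mult_distrib[symmetric])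
    finally have "r ^ card W * (1 - r) ^ card (X - (W \<union> U)) * ((1 - r) ^ card U * q ^ card U)
       \<le> r ^ card W * (1 - r) ^ card (X - (W \<union> U)) * (r ^ card U * (1 / L) ^ card U)"
      using r by (intro mult_left_mono) auto
    then show "r ^ card W * (1 - r) ^ card (X - W) * q ^ card U
       \<le> r ^ card (W \<union> U) * (1 - r) ^ card (X - (W \<union> U)) * (1 / L) ^ card U"
      unfolding c1 c2 power_add by (simp add: mult_ac)
  qed
  also have "\<dots> = (\<Sum>(Z, U)\<in>(\<lambda>(W, U). (W \<union> U, U)) ` A. r ^ card Z * (1 - r) ^ card (X - Z) * (1 / L) ^ card U)"
  proof (subst sum.reindex)
    show "inj_on (\<lambda>(W, U). (W \<union> U, U)) A"
    proof (rule inj_onI)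
      fix a b assume ab: "a \<in> A" "b \<in> A" "(\<lambda>(W, U). (W \<union> U, U)) a = (\<lambda>(W, U). (W \<union> U, U)) b"
      obtain W U W' where a: "a = (W, U)" "b = (W', U)" "W \<union> U = W' \<union> U"
        using ab(3) by (cases a, cases b) auto
      have "U \<inter> W = {}" "U \<inter> W' = {}" using key ab a by (auto simp: A_def)
      then show "a = b" using a by blast
    qed
  qed (simp add: case_prod_unfold)
  also have "\<dots> \<le> (\<Sum>(Z, U)\<in>B. r ^ card Z * (1 - r) ^ card (X - Z) * (1 / L) ^ card U)"
  proof (rule sum_mono2[OF finB])
    show "(\<lambda>(W, U). (W \<union> U, U)) ` A \<subseteq> B"
    proof (rule subsetI)
      fix z assume "z \<in> (\<lambda>(W, U). (W \<union> U, U)) ` A"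
      then obtain W U where z: "z = (W \<union> U, U)" and U: "U \<in> \<U> W" and W: "W \<subseteq> X"
        by (auto simp: A_def)
      have "l < 2 * card U" using U by (auto simp: \<U>_def)
      then show "z \<in> B" using key[OF U W] W by (auto simp: B_def z)
    qed
  qed (use r q in auto)
  also have "\<dots> = (\<Sum>Z\<in>{Z \<in> Pow X. \<exists>S\<in>\<H>. S \<subseteq> Z}. r ^ card Z * (1 - r) ^ card (X - Z) *
       (\<Sum>U | U \<subseteq> pick Z \<and> l < 2 * card U. (1 / L) ^ card U))"
    unfolding B_def sum_distrib_left
  proof (rule sum.Sigma[symmetric])
    show "finite {Z \<in> Pow X. \<exists>S\<in>\<H>. S \<subseteq> Z}" using X by simp
    have "finite {U. U \<subseteq> pick Z \<and> l < 2 * card U}" if "\<exists>S\<in>\<H>. S \<subseteq> Z" for Z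
    proof -
      have "finite (pick Z)" using pick[OF that] fin\<H> by blast
      then show ?thesis by simp
    qed
    then show "\<forall>Z\<in>{Z \<in> Pow X. \<exists>S\<in>\<H>. S \<subseteq> Z}. finite {U. U \<subseteq> pick Z \<and> l < 2 * card U}" by blast
  qed
  also have "\<dots> \<le> (\<Sum>Z\<in>{Z \<in> Pow X. \<exists>S\<in>\<H>. S \<subseteq> Z}. r ^ card Z * (1 - r) ^ card (X - Z) * (2 / sqrt L) ^ l)"
  proof (intro sum_mono mult_left_mono)
    fix Z assume "Z \<in> {Z \<in> Pow X. \<exists>S\<in>\<H>. S \<subseteq> Z}"
    then have P: "pick Z \<in> \<H>" using pick by blast
    have small: "(1 / L) ^ card U \<le> (1 / sqrt L) ^ l" if "l < 2 * card U" for U :: "'a set"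
    proof -
      have "(1 / L) ^ card U = (1 / sqrt L) ^ (2 * card U)"
        using q by (simp add: power_mult power_divide)
      also have "\<dots> \<le> (1 / sqrt L) ^ l" using that q by (intro power_decreasing) auto
      finally show ?thesis .
    qed
    have "(\<Sum>U | U \<subseteq> pick Z \<and> l < 2 * card U. (1 / L) ^ card U)
        \<le> (\<Sum>U | U \<subseteq> pick Z \<and> l < 2 * card U. (1 / sqrt L) ^ l)"
      using small by (intro sum_mono) auto
    also have "\<dots> \<le> (\<Sum>U\<in>Pow (pick Z). (1 / sqrt L) ^ l)"
      using fin\<H>[OF P] q by (intro sum_mono2) auto
    also have "\<dots> = 2 ^ card (pick Z) * (1 / sqrt L) ^ l"
      using fin\<H>[OF P] by (simp add: card_Pow)
    also have "\<dots> \<le> 2 ^ l * (1 / sqrt L) ^ l"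
      using \<H>(2)[OF P] q by (intro mult_right_mono power_increasing) auto
    also have "\<dots> = (2 / sqrt L) ^ l" by (simp add: power_mult_distrib[symmetric])
    finally show "(\<Sum>U | U \<subseteq> pick Z \<and> l < 2 * card U. (1 / L) ^ card U) \<le> (2 / sqrt L) ^ l" .
  qed (use r in auto)
  also have "\<dots> \<le> (\<Sum>Z\<in>Pow X. r ^ card Z * (1 - r) ^ card (X - Z) * (2 / sqrt L) ^ l)"
    using X r q by (intro sum_mono2) auto
  also have "\<dots> = (2 / sqrt L) ^ l"
    using binexp_const[OF X, of r "(2 / sqrt L) ^ l"] by (simp add: binexp_def)
  finally show ?thesis by (simp add: r_def \<U>_def)
qed

text \<open>
  Spend density \<open>L * q\<close> on a first random set \<open>W\<close>. Its large minimum fragments together with a cover of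
  its small ones cover \<open>\<H>\<close>, and hitting a small fragment with the second random set completes a member
  of \<open>\<H>\<close>. Hence the problem passes to families with sets of half the size.
\<close>

lemma fragmentation_step:
  fixes L q B :: real
  assumes X: "finite X" and \<H>: "\<H> \<subseteq> Pow X" "\<And>S. S \<in> \<H> \<Longrightarrow> card S \<le> l"
    and q: "0 < q" "1 \<le> L" and p: "0 \<le> p'" "L * q + p' \<le> p" "p \<le> 1"
    and IH: "\<And>\<F>. \<F> \<subseteq> Pow X \<Longrightarrow> (\<And>S. S \<in> \<F> \<Longrightarrow> 2 * card S \<le> l)
       \<Longrightarrow> min_cost q X \<F> * fail_prob X p' \<F> \<le> B"
  shows "min_cost q X \<H> * fail_prob X p \<H> \<le> (2 / sqrt L) ^ l + B"
proof -
  define r where "r = L * q"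
  define \<U> where "\<U> W = {T \<in> min_fragment \<H> W ` \<H>. l < 2 * card T}" for W
  define \<F> where "\<F> W = {T \<in> min_fragment \<H> W ` \<H>. 2 * card T \<le> l}" for W
  have r: "0 \<le> r" "r \<le> 1" "p' \<le> 1" using q p by (auto simp: r_def) (smt (verit) mult_nonneg_nonneg)+
  have sub: "min_fragment \<H> W S \<subseteq> S \<and> min_fragment \<H> W S \<subseteq> X
     \<and> (\<exists>S'\<in>\<H>. S' \<subseteq> W \<union> min_fragment \<H> W S)" if "S \<in> \<H>" for W S
    using min_fragment_in[OF that, of W] that \<H>(1) by (auto simp: fragments_def)
  have fin: "finite (\<U> W)" for W
  proof -
    have "finite \<H>" using \<H>(1) X by (meson finite_Pow_iff finite_subset)
    then show ?thesis by (auto simp: \<U>_def)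
  qed
  have \<F>: "\<F> W \<subseteq> Pow X" for W using sub by (auto simp: \<F>_def)
  have cost: "min_cost q X \<H> \<le> cost q (\<U> W) + min_cost q X (\<F> W)" for W
  proof -
    obtain \<V> where \<V>: "\<V> \<in> covers X (\<F> W)" "cost q \<V> = min_cost q X (\<F> W)"
      using min_cost_attained[OF X \<F>] by blast
    have "\<U> W \<union> \<V> \<in> covers X \<H>" unfolding covers_def
    proof (safe del: UnE)
      fix S assume S: "S \<in> \<H>"
      show "\<exists>U\<in>\<U> W \<union> \<V>. U \<subseteq> S"
      proof (cases "l < 2 * card (min_fragment \<H> W S)")
        case True then show ?thesis using sub[OF S, of W] S by (auto simp: \<U>_def)
      next
        case False
        then have "min_fragment \<H> W S \<in> \<F> W" using S by (auto simp: \<F>_def)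
        then obtain V where "V \<in> \<V>" "V \<subseteq> min_fragment \<H> W S" using \<V>(1) by (auto simp: covers_def)
        then show ?thesis using sub[OF S, of W] by blast
      qed
    next
      fix U x assume "U \<in> \<U> W \<union> \<V>" "x \<in> U"
      then show "x \<in> X" using sub \<V>(1) by (auto simp: \<U>_def covers_def)
    qed
    then have "min_cost q X \<H> \<le> cost q (\<U> W \<union> \<V>)" by (rule min_cost_le[OF X])
    also have "\<dots> \<le> cost q (\<U> W) + cost q \<V>"
      using fin \<V>(1) X q by (intro cost_Un_le) (auto simp: covers_def intro: finite_subset)
    finally show ?thesis by (simp add: \<V>(2))
  qed
  have "fail_prob X p \<H> \<le> binexp X (r + p' - r * p') (\<lambda>W. if \<exists>S\<in>\<H>. S \<subseteq> W then 0 else 1)"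
    unfolding fail_prob_def
  proof (rule binexp_decreasing[OF X])
    have "r * p' \<le> p'" using r p by (simp add: mult_left_le_one_le)
    then show "0 \<le> r + p' - r * p'" using r by simp
    have "0 \<le> r * p'" using r p by simp
    then show "r + p' - r * p' \<le> p" using p by (simp add: r_def)
  qed (use p in auto)
  also have "\<dots> = binexp X r (\<lambda>W. binexp X p' (\<lambda>W'. if \<exists>S\<in>\<H>. S \<subseteq> W \<union> W' then 0 else 1))"
    by (rule binexp_union[OF X, symmetric])
  also have "\<dots> \<le> binexp X r (\<lambda>W. fail_prob X p' (\<F> W))"
  proof (rule binexp_mono[OF r(1,2)])
    fix W assume "W \<subseteq> X"
    show "binexp X p' (\<lambda>W'. if \<exists>S\<in>\<H>. S \<subseteq> W \<union> W' then 0 else 1) \<le> fail_prob X p' (\<F> W)"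
      unfolding fail_prob_def
    proof (rule binexp_mono[OF p(1) r(3)])
      fix W' assume "W' \<subseteq> X"
      have "\<exists>S\<in>\<H>. S \<subseteq> W \<union> W'" if "T \<in> \<F> W" "T \<subseteq> W'" for T
        using that sub[of _ W] by (auto simp: \<F>_def) (meson Un_mono order_refl order_trans)
      then show "(if \<exists>S\<in>\<H>. S \<subseteq> W \<union> W' then 0 else 1) \<le> (if \<exists>S\<in>\<F> W. S \<subseteq> W' then 0 else (1::real))"
        by auto
    qed
  qed
  finally have "min_cost q X \<H> * fail_prob X p \<H>
      \<le> min_cost q X \<H> * binexp X r (\<lambda>W. fail_prob X p' (\<F> W))"
    using min_cost_nonneg[OF X \<H>(1)] q by (intro mult_left_mono) auto
  also have "\<dots> = binexp X r (\<lambda>W. min_cost q X \<H> * fail_prob X p' (\<F> W))"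
    by (simp add: binexp_cmult)
  also have "\<dots> \<le> binexp X r (\<lambda>W. cost q (\<U> W) + B)"
  proof (rule binexp_mono[OF r(1,2)])
    fix W assume "W \<subseteq> X"
    have f: "0 \<le> fail_prob X p' (\<F> W)" "fail_prob X p' (\<F> W) \<le> 1"
      using fail_prob_nonneg fail_prob_le_1 X p(1) r(3) by blast+
    have c: "0 \<le> cost q (\<U> W)" using q by (auto simp: cost_def intro: sum_nonneg)
    have "min_cost q X \<H> * fail_prob X p' (\<F> W)
       \<le> (cost q (\<U> W) + min_cost q X (\<F> W)) * fail_prob X p' (\<F> W)"
      using cost f by (intro mult_right_mono) auto
    also have "\<dots> \<le> cost q (\<U> W) * 1 + B"
      unfolding distrib_right using f c IH[OF \<F>, of W]
      by (intro add_mono mult_left_mono) (auto simp: \<F>_def)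
    finally show "min_cost q X \<H> * fail_prob X p' (\<F> W) \<le> cost q (\<U> W) + B" by simp
  qed
  also have "\<dots> = binexp X r (\<lambda>W. cost q (\<U> W)) + B" by (simp add: binexp_add binexp_const[OF X])
  also have "\<dots> \<le> (2 / sqrt L) ^ l + B"
    using large_fragments_expected_cost[OF X \<H> q r(2)[unfolded r_def]]
    by (simp only: r_def \<U>_def add_le_cancel_right)
  finally show ?thesis .
qed

lemma fail_prob_iterated:
  fixes L :: "nat \<Rightarrow> real"
  assumes X: "finite X" and q: "0 < q" and L: "\<And>j. 1 \<le> L j"
    and "\<H> \<subseteq> Pow X" "\<And>S. S \<in> \<H> \<Longrightarrow> card S \<le> 2 ^ j"
    and "(\<Sum>i\<le>j. L i * q) \<le> p" "p \<le> 1"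
  shows "min_cost q X \<H> * fail_prob X p \<H> \<le> (\<Sum>i\<le>j. (2 / sqrt (L i)) ^ (2 ^ i))"
  using assms(4-)
proof (induction j arbitrary: \<H> p)
  case 0
  have "min_cost q X \<H> * fail_prob X p \<H> \<le> (2 / sqrt (L 0)) ^ 1 + 0"
  proof (rule fragmentation_step[OF X, where p' = 0])
    fix \<F> :: "'a set set" assume \<F>: "\<F> \<subseteq> Pow X" "\<And>S. S \<in> \<F> \<Longrightarrow> 2 * card S \<le> 1"
    have "S = {}" if "S \<in> \<F>" for S
    proof -
      have "card S = 0" using \<F>(2)[OF that] by linarith
      moreover have "finite S" using that \<F>(1) X by (meson PowD finite_subset subsetD)
      ultimately show ?thesis by simp
    qed
    then consider "\<F> = {}" | "{} \<in> \<F>" by (cases "\<F> = {}") auto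
    then show "min_cost q X \<F> * fail_prob X 0 \<F> \<le> 0"
    proof cases
      case 1
      have "{} \<in> covers X \<F>" using 1 by (simp add: covers_def)
      then have "min_cost q X \<F> \<le> 0" using min_cost_le[OF X, of "{}" \<F> q] by (simp add: cost_def)
      then show ?thesis using fail_prob_nonneg[of 0 X \<F>] by (simp add: mult_nonpos_nonneg)
    next
      case 2
      then have "fail_prob X 0 \<F> = 0" by (auto simp: fail_prob_def binexp_def intro!: sum.neutral)
      then show ?thesis by simp
    qed
  qed (use 0 q L in auto)
  then show ?case by simp
next
  case (Suc j)
  have nn: "0 \<le> L i * q" for i using L[of i] q by simp
  define p' where "p' = (\<Sum>i\<le>j. L i * q)"
  have p': "0 \<le> p'" unfolding p'_def by (intro sum_nonneg nn)
  have le: "L (Suc j) * q + p' \<le> p" using Suc.prems(3) by (simp add: p'_def)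
  have IH: "min_cost q X \<F> * fail_prob X p' \<F> \<le> (\<Sum>i\<le>j. (2 / sqrt (L i)) ^ 2 ^ i)"
    if \<F>: "\<F> \<subseteq> Pow X" "\<And>S. S \<in> \<F> \<Longrightarrow> 2 * card S \<le> 2 ^ Suc j" for \<F>
  proof (rule Suc.IH[OF \<F>(1)])
    show "card S \<le> 2 ^ j" if "S \<in> \<F>" for S using \<F>(2)[OF that] by simp
    show "(\<Sum>i\<le>j. L i * q) \<le> p'" by (simp add: p'_def)
    show "p' \<le> 1" using le nn[of "Suc j"] Suc.prems(4) by linarith
  qed
  show ?case
    using fragmentation_step[OF X Suc.prems(1,2) q L p' le Suc.prems(4) IH] by (simp add: add.commute)
qed

text \<open>
  The distribution is that of \<open>S i\<close> for uniform \<open>i \<in> I\<close>. Spreadness makes every cover cost at least 1, so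
  that iterated fragmentation bounds the failure probability itself.
\<close>

theorem spread_imp_likely:
  fixes S :: "'i \<Rightarrow> 'a set" and q p :: real
  assumes X: "finite X" and I: "finite I" "I \<noteq> {}" and S: "\<And>i. i \<in> I \<Longrightarrow> S i \<subseteq> X"
    "\<And>i. i \<in> I \<Longrightarrow> card (S i) \<le> 2 ^ k"
    and q: "0 < q" and spread: "\<And>U. U \<subseteq> X \<Longrightarrow> real (card {i \<in> I. U \<subseteq> S i}) \<le> q ^ card U * real (card I)"
    and p: "256 * (3 * real k + 1) * q \<le> p" "p \<le> 1"
  shows "1 - 1 / sqrt (1 + real k) \<le> binexp X p (\<lambda>W. if \<exists>i\<in>I. S i \<subseteq> W then 1 else 0)"
proof -
  \<comment> \<open>The sum of the \<open>L j\<close> is linear in \<open>k\<close>, while by Bernoulli's inequality the summand \<open>k / 2^j\<close>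
    gains a factor \<open>1 / sqrt (1 + k)\<close> in the error of each step, also in the last few steps.\<close>
  define L :: "nat \<Rightarrow> real" where "L j = 256 * (1 + real k / 2 ^ j)" for j
  have L: "1 \<le> L j" for j by (simp add: L_def add_increasing2)
  have "0 \<le> 256 * (3 * real k + 1) * q" using q by simp
  then have p0: "0 \<le> p" using p(1) by linarith
  have geo: "(\<Sum>j\<le>k. (1 / 2) ^ j) \<le> (2::real)" for k :: nat
    by (simp add: sum_gp_strict lessThan_Suc_atMost[symmetric])
  have "(\<Sum>j\<le>k. L j) = 256 * (real (k + 1) + real k * (\<Sum>j\<le>k. (1 / 2) ^ j))"
    by (simp add: L_def sum_distrib_left sum.distrib algebra_simps power_divide)
  also have "\<dots> \<le> 256 * (real (k + 1) + real k * 2)"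
    using geo[of k] by (intro mult_left_mono add_mono) auto
  also have "\<dots> = 256 * (3 * real k + 1)" by simp
  finally have "(\<Sum>j\<le>k. L j) * q \<le> 256 * (3 * real k + 1) * q" using q by (intro mult_right_mono) auto
  then have sumL: "(\<Sum>j\<le>k. L j * q) \<le> p" using p by (simp add: sum_distrib_right)
  have eps: "(2 / sqrt (L j)) ^ (2 ^ j) \<le> (1 / sqrt (1 + real k)) * ((1 / 2) ^ j * (1 / 2))" for j
  proof -
    have "1 + real k = 1 + real (2 ^ j) * (real k / 2 ^ j)" by simp
    also have "\<dots> \<le> (1 + real k / 2 ^ j) ^ (2 ^ j)"
      by (rule Bernoulli_inequality) (simp add: order.trans[of _ 0])
    finally have b: "sqrt (1 + real k) \<le> sqrt (1 + real k / 2 ^ j) ^ (2 ^ j)"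
      by (simp add: real_sqrt_power[symmetric])
    have "sqrt 256 = 16" by (rule real_sqrt_unique) auto
    then have "sqrt (L j) = 16 * sqrt (1 + real k / 2 ^ j)" by (simp only: L_def real_sqrt_mult)
    then have "(2 / sqrt (L j)) ^ (2 ^ j) = (1 / 8) ^ (2 ^ j) * (1 / sqrt (1 + real k / 2 ^ j) ^ (2 ^ j))"
      by (simp add: power_mult_distrib power_divide)
    also have "\<dots> \<le> (1 / 2) ^ (Suc j) * (1 / sqrt (1 + real k))"
    proof (rule mult_mono)
      have "(1 / 8 :: real) ^ (2 ^ j) \<le> (1 / 2) ^ (2 ^ j)" by (intro power_mono) auto
      also have "\<dots> \<le> (1 / 2) ^ (Suc j)" by (intro power_decreasing) (auto simp: Suc_leI)
      finally show "(1 / 8 :: real) ^ (2 ^ j) \<le> (1 / 2) ^ (Suc j)" .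
      have s: "0 < sqrt (1 + real k)" by simp
      show "1 / sqrt (1 + real k / 2 ^ j) ^ (2 ^ j) \<le> 1 / sqrt (1 + real k)"
        by (rule frac_le[OF _ order.refl s b]) simp
      show "0 \<le> (1 / 2 :: real) ^ Suc j" by simp
      show "0 \<le> 1 / sqrt (1 + real k / 2 ^ j) ^ (2 ^ j)" by simp
    qed
    also have "\<dots> = (1 / sqrt (1 + real k)) * ((1 / 2) ^ j * (1 / 2))" by simp
    finally show ?thesis .
  qed
  define \<H> where "\<H> = S ` I"
  have "1 \<le> min_cost q X \<H>"
  proof -
    obtain \<U> where \<U>: "\<U> \<in> covers X \<H>" "cost q \<U> = min_cost q X \<H>"
      using min_cost_attained[OF X, of \<H> q] S by (auto simp: \<H>_def)
    have fin: "finite \<U>" using \<U>(1) X by (auto simp: covers_def intro: finite_subset)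
    have "I \<subseteq> (\<Union>U\<in>\<U>. {i \<in> I. U \<subseteq> S i})" using \<U>(1) by (auto simp: covers_def \<H>_def)
    then have "card I \<le> card (\<Union>U\<in>\<U>. {i \<in> I. U \<subseteq> S i})" using I fin by (intro card_mono) auto
    also have "\<dots> \<le> (\<Sum>U\<in>\<U>. card {i \<in> I. U \<subseteq> S i})" by (rule card_UN_le[OF fin])
    finally have "real (card I) \<le> (\<Sum>U\<in>\<U>. real (card {i \<in> I. U \<subseteq> S i}))"
      unfolding of_nat_sum[symmetric] of_nat_le_iff .
    also have "\<dots> \<le> (\<Sum>U\<in>\<U>. q ^ card U * real (card I))"
      using spread \<U>(1) by (intro sum_mono) (auto simp: covers_def)
    also have "\<dots> = cost q \<U> * real (card I)" by (simp add: cost_def sum_distrib_right)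
    finally show ?thesis using I \<U>(2) by (simp add: card_gt_0_iff)
  qed
  then have "fail_prob X p \<H> \<le> min_cost q X \<H> * fail_prob X p \<H>"
    using fail_prob_nonneg[OF p0 p(2), of X \<H>] by (simp add: mult_le_cancel_right1)
  also have "\<dots> \<le> (\<Sum>j\<le>k. (2 / sqrt (L j)) ^ (2 ^ j))"
    by (rule fail_prob_iterated[OF X q L]) (use S sumL p in \<open>auto simp: \<H>_def\<close>)
  also have "\<dots> \<le> (\<Sum>j\<le>k. (1 / sqrt (1 + real k)) * ((1 / 2) ^ j * (1 / 2)))"
    by (intro sum_mono eps)
  also have "\<dots> = (1 / sqrt (1 + real k)) * ((\<Sum>j\<le>k. (1 / 2) ^ j) / 2)"
    by (simp add: sum_distrib_left sum_divide_distrib)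
  also have "\<dots> \<le> (1 / sqrt (1 + real k)) * 1"
    using geo[of k] by (intro mult_left_mono) auto
  finally have "fail_prob X p \<H> \<le> 1 / sqrt (1 + real k)" by simp
  moreover have "binexp X p (\<lambda>W. if \<exists>i\<in>I. S i \<subseteq> W then 1 else 0) + fail_prob X p \<H> = 1"
    unfolding fail_prob_def \<H>_def binexp_add[symmetric]
  proof -
    have "(\<lambda>W. (if \<exists>i\<in>I. S i \<subseteq> W then 1 else 0) + (if \<exists>S\<in>S ` I. S \<subseteq> W then 0 else 1)) = (\<lambda>_. 1::real)"
      by auto
    then show "binexp X p (\<lambda>W. (if \<exists>i\<in>I. S i \<subseteq> W then 1 else 0) + (if \<exists>S\<in>S ` I. S \<subseteq> W then 0 else 1)) = 1"
      by (simp only: binexp_const[OF X])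
  qed
  ultimately show ?thesis by linarith
qed

section \<open>Sets of functions closed under many swaps\<close>

text \<open>
  The transposition of two points.
\<close>

abbreviation switch :: "'a \<Rightarrow> 'a \<Rightarrow> 'a \<Rightarrow> 'a" where
  "switch \<equiv> Transposition.transpose"

text \<open>
  The vertices \<open>x'\<close> in \<open>Q\<close> such that exchanging the values of \<open>\<phi>\<close> at \<open>x\<close> and \<open>x'\<close> stays in \<open>E\<close>. The choice
  \<open>x' = x\<close> is allowed.
\<close>

definition swaps :: "('a \<Rightarrow> 'b) set \<Rightarrow> ('a \<Rightarrow> 'b) \<Rightarrow> 'a \<Rightarrow> 'a set \<Rightarrow> 'a set" where
  "swaps E \<phi> x Q = {x' \<in> Q. \<phi> \<circ> switch x x' \<in> E}"

lemma finite_swaps [simp]: "finite Q \<Longrightarrow> finite (swaps E \<phi> x Q)"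
  by (simp add: swaps_def)

lemma swaps_restrict: "Q \<subseteq> V \<Longrightarrow> swaps E \<phi> x Q = swaps E \<phi> x V \<inter> Q"
  by (auto simp: swaps_def)

lemma self_in_swaps: "\<phi> \<in> E \<Longrightarrow> x \<in> Q \<Longrightarrow> x \<in> swaps E \<phi> x Q"
  by (simp add: swaps_def)

text \<open>
  The sum, over the steps of revealing \<open>\<phi>\<close> along the list, of the logarithm of the number of swap
  partners among the vertices not yet revealed (including the current one).
\<close>

fun swap_entropy :: "('a \<Rightarrow> 'b) set \<Rightarrow> ('a \<Rightarrow> 'b) \<Rightarrow> 'a list \<Rightarrow> real" where
  "swap_entropy E \<phi> [] = 0"
| "swap_entropy E \<phi> (x # xs) = ln (real (card (swaps E \<phi> x (set (x # xs))))) + swap_entropy E \<phi> xs"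

lemma swap_entropy_fibre:
  "x \<notin> set xs \<Longrightarrow> swap_entropy {\<psi> \<in> E. \<psi> x = \<phi> x} \<phi> xs = swap_entropy E \<phi> xs"
proof (induction xs)
  case (Cons z xs)
  have "swaps {\<psi> \<in> E. \<psi> x = \<phi> x} \<phi> z (set (z # xs)) = swaps E \<phi> z (set (z # xs))"
    using Cons.prems by (auto simp: swaps_def Transposition.transpose_def)
  then show ?case using Cons by simp
qed simp

text \<open>
  Concavity of the logarithm: the mean of \<open>ln \<circ> f\<close> is at most the logarithm of any bound for the mean.
\<close>

lemma sum_ln_le:
  fixes f :: "'a \<Rightarrow> real"
  assumes "finite A" "A \<noteq> {}" "\<And>x. x \<in> A \<Longrightarrow> 0 < f x" "sum f A \<le> M"
  shows "(\<Sum>x\<in>A. ln (f x)) \<le> card A * ln (M / card A)"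
proof -
  define K where "K = M / card A"
  have c: "0 < card A" using assms by (simp add: card_gt_0_iff)
  have "0 < sum f A" using assms by (intro sum_pos) auto
  then have K: "0 < K" using assms(4) c by (simp add: K_def)
  have "(\<Sum>x\<in>A. ln (f x)) \<le> (\<Sum>x\<in>A. ln K + (f x / K - 1))"
  proof (rule sum_mono)
    fix x assume "x \<in> A"
    then have "0 < f x" by (rule assms(3))
    moreover from this have "ln (f x / K) \<le> f x / K - 1" using K by (intro ln_le_minus_one) simp
    ultimately show "ln (f x) \<le> ln K + (f x / K - 1)" using K by (simp add: ln_div)
  qed
  also have "\<dots> = card A * ln K + sum f A / K - card A"
    by (simp add: sum.distrib sum_subtractf sum_divide_distrib)
  also have "sum f A / K \<le> M / K" using assms(4) K by (intro divide_right_mono) auto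
  also have "M / K = card A" using K c by (simp add: K_def field_simps)
  finally show ?thesis by (simp add: K_def)
qed

text \<open>
  Double counting of swaps: the result \<open>\<phi> \<circ> switch x x'\<close> determines \<open>x'\<close> as the unique place with value
  \<open>y\<close>, and hence \<open>\<phi>\<close>.
\<close>

lemma sum_card_swaps_le:
  assumes E: "finite E" "\<And>\<phi>. \<phi> \<in> E \<Longrightarrow> inj_on \<phi> Q" and Q: "finite Q" "x \<in> Q"
    and F: "F \<subseteq> E" "\<And>\<phi>. \<phi> \<in> F \<Longrightarrow> \<phi> x = y"
  shows "(\<Sum>\<phi>\<in>F. card (swaps E \<phi> x Q)) \<le> card E"
proof -
  have finF: "finite F" using F E finite_subset by blast
  have "(\<Sum>\<phi>\<in>F. card (swaps E \<phi> x Q)) = card (Sigma F (\<lambda>\<phi>. swaps E \<phi> x Q))"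
    using finF Q by (subst card_SigmaI) auto
  also have "\<dots> \<le> card E"
  proof (rule card_inj_on_le[of "\<lambda>(\<phi>, x'). \<phi> \<circ> switch x x'"])
    show "inj_on (\<lambda>(\<phi>, x'). \<phi> \<circ> switch x x') (Sigma F (\<lambda>\<phi>. swaps E \<phi> x Q))"
    proof (rule inj_onI)
      fix a b assume ab: "a \<in> Sigma F (\<lambda>\<phi>. swaps E \<phi> x Q)" "b \<in> Sigma F (\<lambda>\<phi>. swaps E \<phi> x Q)"
        "(\<lambda>(\<phi>, x'). \<phi> \<circ> switch x x') a = (\<lambda>(\<phi>, x'). \<phi> \<circ> switch x x') b"
      obtain \<phi> u \<psi> v where a: "a = (\<phi>, u)" and b: "b = (\<psi>, v)" by (cases a, cases b)
      have eq: "\<phi> \<circ> switch x u = \<psi> \<circ> switch x v" using ab(3) a b by simp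
      have "(\<phi> \<circ> switch x u) u = y" using ab(1) F(2) a by simp
      moreover have "(\<phi> \<circ> switch x u) v = y" unfolding eq using ab(2) F(2) b by simp
      moreover have "inj_on (\<phi> \<circ> switch x u) Q" "u \<in> Q" "v \<in> Q"
        using ab(1,2) a b E(2) by (auto simp: swaps_def)
      ultimately have "u = v" by (metis inj_onD)
      then have "(\<phi> \<circ> switch x u) \<circ> switch x u = (\<psi> \<circ> switch x u) \<circ> switch x u"
        using eq by simp
      then have "\<phi> = \<psi>" by (simp add: comp_assoc)
      then show "a = b" using a b \<open>u = v\<close> by simp
    qed
  qed (use E in \<open>auto simp: swaps_def\<close>)
  finally show ?thesis .
qed

text \<open>
  The chain rule for the entropy of a uniform element of \<open>E\<close>: split \<open>E\<close> according to the value \<open>y\<close> at the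
  first vertex \<open>x\<close>. Swaps that exchange \<open>x\<close> show that the fibre of \<open>y\<close> has size at most \<open>|E|\<close> divided by
  the mean number of swap partners, and the later swaps do not leave the fibre.
\<close>

lemma swap_entropy_le:
  assumes "finite E" "distinct xs" "\<And>\<phi>. \<phi> \<in> E \<Longrightarrow> inj_on \<phi> (set xs)"
  shows "(\<Sum>\<phi>\<in>E. swap_entropy E \<phi> xs) \<le> card E * ln (card E)"
  using assms
proof (induction xs arbitrary: E)
  case Nil
  have "0 \<le> real (card E) * ln (real (card E))" by (cases "card E") auto
  then show ?case by simp
next
  case (Cons x xs)
  define F where "F y = {\<phi> \<in> E. \<phi> x = y}" for y
  define Y where "Y = (\<lambda>\<phi>. \<phi> x) ` E"
  have finY: "finite Y" using Cons.prems by (simp add: Y_def)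
  have fibre: "(\<Sum>\<phi>\<in>F y. swap_entropy E \<phi> (x # xs)) \<le> card (F y) * ln (card E)" if "y \<in> Y" for y
  proof -
    have F: "finite (F y)" "F y \<noteq> {}" "F y \<subseteq> E" using that Cons.prems(1) by (auto simp: F_def Y_def)
    then have c: "0 < card (F y)" by (simp add: card_gt_0_iff)
    have cE: "0 < card E" using F Cons.prems(1) by (auto simp: card_gt_0_iff)
    have "(\<Sum>\<phi>\<in>F y. swap_entropy E \<phi> xs) = (\<Sum>\<phi>\<in>F y. swap_entropy (F y) \<phi> xs)"
    proof (rule sum.cong[OF refl])
      fix \<phi> assume "\<phi> \<in> F y"
      then have "F y = {\<psi> \<in> E. \<psi> x = \<phi> x}" by (auto simp: F_def)
      then show "swap_entropy E \<phi> xs = swap_entropy (F y) \<phi> xs"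
        using swap_entropy_fibre[of x xs E \<phi>] Cons.prems(2) by simp
    qed
    also have "\<dots> \<le> card (F y) * ln (card (F y))"
    proof (rule Cons.IH)
      show "inj_on \<phi> (set xs)" if "\<phi> \<in> F y" for \<phi>
        using Cons.prems(3)[of \<phi>] that F(3) by auto
    qed (use F Cons.prems in auto)
    finally have 1: "(\<Sum>\<phi>\<in>F y. swap_entropy E \<phi> xs) \<le> card (F y) * ln (card (F y))" .
    have "(\<Sum>\<phi>\<in>F y. ln (real (card (swaps E \<phi> x (set (x # xs))))))
        \<le> card (F y) * ln (real (card E) / card (F y))"
    proof (rule sum_ln_le[OF F(1,2)])
      fix \<phi> assume "\<phi> \<in> F y"
      then have "x \<in> swaps E \<phi> x (set (x # xs))" using F(3) by (intro self_in_swaps) auto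
      then show "0 < real (card (swaps E \<phi> x (set (x # xs))))"
        by (metis card_gt_0_iff empty_iff finite_swaps List.finite_set of_nat_0_less_iff)
    next
      have "(\<Sum>\<phi>\<in>F y. card (swaps E \<phi> x (set (x # xs)))) \<le> card E"
        by (rule sum_card_swaps_le[where y = y]) (use Cons.prems F in \<open>auto simp: F_def\<close>)
      then show "(\<Sum>\<phi>\<in>F y. real (card (swaps E \<phi> x (set (x # xs))))) \<le> real (card E)"
        unfolding of_nat_sum[symmetric] of_nat_le_iff .
    qed
    also have "\<dots> = card (F y) * ln (card E) - card (F y) * ln (card (F y))"
      using c cE by (simp add: ln_div algebra_simps)
    finally show ?thesis using 1 by (simp add: sum.distrib)
  qed
  have "(\<Sum>\<phi>\<in>E. swap_entropy E \<phi> (x # xs)) = (\<Sum>y\<in>Y. \<Sum>\<phi>\<in>F y. swap_entropy E \<phi> (x # xs))"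
    unfolding F_def Y_def by (rule sum.image_gen[OF Cons.prems(1)])
  also have "\<dots> \<le> (\<Sum>y\<in>Y. card (F y) * ln (card E))" by (rule sum_mono[OF fibre])
  also have "\<dots> = real (\<Sum>y\<in>Y. card (F y)) * ln (card E)"
    by (simp only: of_nat_sum sum_distrib_right)
  also have "(\<Sum>y\<in>Y. card (F y)) = card E"
    using sum.image_gen[OF Cons.prems(1), of "\<lambda>_. 1 :: nat" "\<lambda>\<phi>. \<phi> x"]
    by (simp only: F_def Y_def card_eq_sum)
  finally show ?case .
qed

lemma swap_entropy_eq_sum:
  "swap_entropy E \<phi> xs = (\<Sum>i<length xs. ln (real (card (swaps E \<phi> (xs ! i) (set (drop i xs))))))"
  by (induction xs) (simp_all add: sum.lessThan_Suc_shift del: sum.lessThan_Suc)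

lemma set_drop_eq_image: "set (drop i ys) = (!) ys ` {i..<length ys}"
proof (intro equalityI subsetI)
  fix y assume "y \<in> set (drop i ys)"
  then obtain k where "k < length ys - i" "y = ys ! (i + k)" by (auto simp: set_conv_nth)
  then show "y \<in> (!) ys ` {i..<length ys}" by (intro image_eqI[of _ _ "i + k"]) auto
next
  fix y assume "y \<in> (!) ys ` {i..<length ys}"
  then obtain k where "i \<le> k" "k < length ys" "y = ys ! k" by auto
  then show "y \<in> set (drop i ys)" by (auto simp: set_conv_nth intro!: exI[of _ "k - i"])
qed

text \<open>
  In a random order of \<open>V\<close> given that \<open>x\<close> comes at position \<open>i\<close>, the mean of \<open>1 / |A \<inter> suffix|\<close> is at most
  \<open>|V| / (|suffix| |A|)\<close>. By symmetry every \<open>a \<in> A\<close> and every position \<open>j \<ge> i\<close> contribute as much as \<open>x\<close>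
  and \<open>i\<close>, and all contributions together add up to at most the number of orders.
\<close>

lemma sum_inverse_card_suffix_fixed:
  assumes V: "finite V" and i: "i < card V" and A: "x \<in> A" "A \<subseteq> V"
  shows "real (card V - i) * real (card A) *
     (\<Sum>xs | xs \<in> permutations_of_set V \<and> xs ! i = x. 1 / real (card (A \<inter> set (drop i xs))))
     \<le> card (permutations_of_set V)"
proof -
  define g where "g xs = 1 / real (card (A \<inter> set (drop i xs)))" for xs
  define P where "P j a = {xs \<in> permutations_of_set V. xs ! j = a}" for j a
  have len: "length xs = card V" and dist: "distinct xs" and set: "set xs = V"
    if "xs \<in> permutations_of_set V" for xs
    using that by (auto simp: permutations_of_set_def distinct_card)
  have finA: "finite A" using A V finite_subset by blast
  have sym: "sum g (P j a) = sum g (P i x)" if j: "i \<le> j" "j < card V" and a: "a \<in> A" for j a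
    \<comment> \<open>The involution exchanges the places \<open>i\<close> and \<open>j\<close> and renames \<open>a\<close> to \<open>x\<close> and conversely; it preserves
      the number of elements of \<open>A\<close> in the suffix because \<open>a\<close> and \<open>x\<close> both belong to \<open>A\<close>.\<close>
  proof (rule sum.reindex_bij_witness[where
        i = "\<lambda>xs. map (switch a x) (permute_list (switch i j) xs)" and
        j = "\<lambda>xs. map (switch a x) (permute_list (switch i j) xs)"])
    have tp: "switch i j permutes {..<card V}" using i j by (intro permutes_swap_id) auto
    have suf: "switch i j permutes {i..<card V}" using i j by (intro permutes_swap_id) auto
    fix xs
    have main: "map (switch a x) (permute_list (switch i j) xs) \<in> permutations_of_set V \<and>
        g (map (switch a x) (permute_list (switch i j) xs)) = g xs \<and>
        map (switch a x) (permute_list (switch i j) (map (switch a x) (permute_list (switch i j) xs))) = xs"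
      if xs: "xs \<in> permutations_of_set V"
    proof (intro conjI)
      note xs' = len[OF xs] dist[OF xs] set[OF xs]
      have tl: "switch i j permutes {..<length xs}" using tp xs' by simp
      show "map (switch a x) (permute_list (switch i j) xs) \<in> permutations_of_set V"
      proof -
        have "switch a x ` V = V" using a A by (intro transpose_image_eq) auto
        then show ?thesis using xs' tl
          by (simp add: permutations_of_set_def distinct_map)
      qed
      have nth: "map (switch a x) (permute_list (switch i j) xs) ! k = switch a x (xs ! switch i j k)"
        if "k < card V" for k using that xs' tl by (simp add: permute_list_nth)
      have "set (drop i (map (switch a x) (permute_list (switch i j) xs)))
          = (\<lambda>k. switch a x (xs ! switch i j k)) ` {i..<card V}"
        unfolding set_drop_eq_image using xs' nth by (auto simp: image_iff)
      also have "\<dots> = switch a x ` ((!) xs ` (switch i j ` {i..<card V}))"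
        by (simp only: image_image)
      also have "\<dots> = switch a x ` set (drop i xs)"
        unfolding permutes_image[OF suf] set_drop_eq_image using xs' by simp
      finally have "A \<inter> set (drop i (map (switch a x) (permute_list (switch i j) xs)))
          = switch a x ` (A \<inter> set (drop i xs))"
        using A(1) a by (simp add: image_Int)
      then show "g (map (switch a x) (permute_list (switch i j) xs)) = g xs"
        unfolding g_def by (simp add: card_image)
      show "map (switch a x) (permute_list (switch i j) (map (switch a x) (permute_list (switch i j) xs))) = xs"
        (is "?\<tau> (?\<tau> xs) = xs")
      proof (rule nth_equalityI)
        fix k assume "k < length (?\<tau> (?\<tau> xs))"
        then have k: "k < card V" using xs' by simp
        have "switch i j k < card V" using permutes_in_image[OF tp, of k] k by simp
        then show "?\<tau> (?\<tau> xs) ! k = xs ! k"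
          using k xs' tl nth[of "switch i j k"] by (simp add: permute_list_nth)
      qed simp
    qed
    show "map (switch a x) (permute_list (switch i j) (map (switch a x) (permute_list (switch i j) xs))) = xs"
      if "xs \<in> P j a" using main that by (simp add: P_def)
    show "map (switch a x) (permute_list (switch i j) (map (switch a x) (permute_list (switch i j) xs))) = xs"
      if "xs \<in> P i x" using main that by (simp add: P_def)
    show "map (switch a x) (permute_list (switch i j) xs) \<in> P i x" if "xs \<in> P j a"
      using main that i len[of xs] tp by (auto simp: P_def permute_list_nth)
    show "map (switch a x) (permute_list (switch i j) xs) \<in> P j a" if "xs \<in> P i x"
      using main that j len[of xs] tp by (auto simp: P_def permute_list_nth)
    show "g (map (switch a x) (permute_list (switch i j) xs)) = g xs" if "xs \<in> P j a"
      using main that by (simp add: P_def)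
  qed
  have "real (card V - i) * real (card A) * sum g (P i x) = (\<Sum>j\<in>{i..<card V}. \<Sum>a\<in>A. sum g (P j a))"
    using sym by simp
  also have "\<dots> = (\<Sum>xs\<in>permutations_of_set V. \<Sum>j\<in>{i..<card V}. \<Sum>a\<in>A. if xs ! j = a then g xs else 0)"
  proof -
    have "sum g (P j a) = (\<Sum>xs\<in>permutations_of_set V. if xs ! j = a then g xs else 0)" for j a
      unfolding P_def by (rule sum.inter_filter) simp
    then have "(\<Sum>j\<in>{i..<card V}. \<Sum>a\<in>A. sum g (P j a))
        = (\<Sum>j\<in>{i..<card V}. \<Sum>xs\<in>permutations_of_set V. \<Sum>a\<in>A. if xs ! j = a then g xs else 0)"
      by (simp only: sum.swap[of _ _ A])
    then show ?thesis by (simp only: sum.swap[of _ _ "{i..<card V}"])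
  qed
  also have "\<dots> \<le> (\<Sum>xs\<in>permutations_of_set V. 1)"
  proof (rule sum_mono)
    fix xs assume xs: "xs \<in> permutations_of_set V"
    have "(\<Sum>j\<in>{i..<card V}. \<Sum>a\<in>A. if xs ! j = a then g xs else 0)
        = (\<Sum>j\<in>{i..<card V}. if xs ! j \<in> A then g xs else 0)"
      using finA by simp
    also have "\<dots> = real (card {j \<in> {i..<card V}. xs ! j \<in> A}) * g xs"
      by (simp add: sum.If_cases Int_def)
    finally have eq: "(\<Sum>j\<in>{i..<card V}. \<Sum>a\<in>A. if xs ! j = a then g xs else 0)
        = real (card {j \<in> {i..<card V}. xs ! j \<in> A}) * g xs" .
    have "card {j \<in> {i..<card V}. xs ! j \<in> A} \<le> card (A \<inter> set (drop i xs))"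
    proof (rule card_inj_on_le[of "(!) xs"])
      show "inj_on ((!) xs) {j \<in> {i..<card V}. xs ! j \<in> A}"
        using dist[OF xs] len[OF xs] by (auto simp: inj_on_def nth_eq_iff_index_eq)
      show "(!) xs ` {j \<in> {i..<card V}. xs ! j \<in> A} \<subseteq> A \<inter> set (drop i xs)"
        using len[OF xs] by (auto simp: set_drop_eq_image)
    qed (use finA in auto)
    then show "(\<Sum>j\<in>{i..<card V}. \<Sum>a\<in>A. if xs ! j = a then g xs else 0) \<le> 1"
      unfolding eq by (simp add: g_def divide_le_eq_1 card_gt_0_iff)
  qed
  finally show ?thesis by (simp add: g_def P_def)
qed

lemma sum_inverse_card_suffix:
  fixes c :: real
  assumes V: "finite V" and i: "i < card V" and c: "0 < c"
    and A: "\<And>x. x \<in> V \<Longrightarrow> x \<in> A x \<and> A x \<subseteq> V \<and> c * card V \<le> card (A x)"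
  shows "(\<Sum>xs\<in>permutations_of_set V. c * real (card V - i) / real (card (A (xs ! i) \<inter> set (drop i xs))))
     \<le> card (permutations_of_set V)"
proof -
  define N where "N = real (card (permutations_of_set V))"
  define s where "s x = (\<Sum>xs | xs \<in> permutations_of_set V \<and> xs ! i = x. 1 / real (card (A x \<inter> set (drop i xs))))" for x
  have s: "c * real (card V - i) * s x \<le> N / card V" if x: "x \<in> V" for x
  proof -
    have s0: "0 \<le> s x" unfolding s_def by (intro sum_nonneg) auto
    have "c * real (card V - i) * s x * card V = c * card V * (real (card V - i) * s x)" by simp
    also have "\<dots> \<le> card (A x) * (real (card V - i) * s x)"
      using A[OF x] s0 by (intro mult_right_mono) auto
    also have "\<dots> = real (card V - i) * card (A x) * s x" by simp
    also have "\<dots> \<le> N"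
      unfolding s_def N_def using A[OF x] by (intro sum_inverse_card_suffix_fixed[OF V i]) auto
    finally show ?thesis using i by (simp add: field_simps)
  qed
  have "(\<Sum>xs\<in>permutations_of_set V. c * real (card V - i) / real (card (A (xs ! i) \<inter> set (drop i xs))))
     = (\<Sum>x\<in>V. \<Sum>xs | xs \<in> permutations_of_set V \<and> xs ! i = x.
          c * real (card V - i) / real (card (A (xs ! i) \<inter> set (drop i xs))))"
  proof (rule sum.group[symmetric])
    show "(\<lambda>xs. xs ! i) ` permutations_of_set V \<subseteq> V"
      using i by (auto simp: permutations_of_set_def distinct_card[symmetric])
  qed (use V in auto)
  also have "\<dots> = (\<Sum>x\<in>V. c * real (card V - i) * s x)"
    unfolding s_def sum_distrib_left by (intro sum.cong) auto
  also have "\<dots> \<le> (\<Sum>x\<in>V. N / card V)" by (intro sum_mono s)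
  also have "\<dots> = N" using i by simp
  finally show ?thesis by (simp add: N_def)
qed

text \<open>
  The expected entropy bound over a uniformly random order: the term for a hidden set of \<open>m\<close> vertices is at
  least \<open>ln (c * m)\<close>, and these terms add up to \<open>ln (c^n * n!)\<close>.
\<close>

lemma card_ge_of_many_swaps:
  fixes c :: real
  assumes E: "finite E" "E \<noteq> {}" "\<And>\<phi>. \<phi> \<in> E \<Longrightarrow> inj_on \<phi> V" and V: "finite V" and c: "0 < c"
    and sw: "\<And>\<phi> x. \<phi> \<in> E \<Longrightarrow> x \<in> V \<Longrightarrow> c * card V \<le> card (swaps E \<phi> x V)"
  shows "c ^ card V * fact (card V) \<le> card E"
proof -
  define n where "n = card V"
  define P where "P = permutations_of_set V"
  have P: "finite P" "P \<noteq> {}" using V by (auto simp: P_def permutations_of_set_empty_iff)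
  then have cP: "0 < real (card P)" by (simp add: card_gt_0_iff)
  have cE: "0 < real (card E)" using E by (simp add: card_gt_0_iff)
  have pos: "0 < c ^ n * fact n" using c by simp
  have low: "card P * ln (c ^ n * fact n) \<le> (\<Sum>xs\<in>P. swap_entropy E \<phi> xs)" if \<phi>: "\<phi> \<in> E" for \<phi>
  proof -
    define A where "A x = swaps E \<phi> x V" for x
    have A: "x \<in> A x \<and> A x \<subseteq> V \<and> c * card V \<le> card (A x)" if "x \<in> V" for x
      using that \<phi> sw by (auto simp: A_def self_in_swaps) (auto simp: swaps_def)
    have "ln (c ^ n * fact n) = ln (\<Prod>i<n. c * real (n - i))"
      by (simp add: fact_prod_rev atLeast0LessThan prod.distrib)
    also have "\<dots> = (\<Sum>i<n. ln (c * real (n - i)))" using c by (intro ln_prod) auto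
    finally have "card P * ln (c ^ n * fact n) = (\<Sum>i<n. card P * ln (c * real (n - i)))"
      by (simp add: sum_distrib_left)
    also have "\<dots> \<le> (\<Sum>i<n. \<Sum>xs\<in>P. ln (real (card (A (xs ! i) \<inter> set (drop i xs)))))"
    proof (rule sum_mono)
      fix i assume "i \<in> {..<n}"
      then have i: "i < n" by simp
      define K where "K = c * real (n - i)"
      have K: "0 < K" using c i by (simp add: K_def)
      have "(\<Sum>xs\<in>P. ln K + (1 - K / real (card (A (xs ! i) \<inter> set (drop i xs)))))
         \<le> (\<Sum>xs\<in>P. ln (real (card (A (xs ! i) \<inter> set (drop i xs)))))"
      proof (rule sum_mono)
        fix xs assume "xs \<in> P"
        then have xs: "set xs = V" "length xs = n" by (auto simp: P_def n_def permutations_of_set_def distinct_card)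
        have "xs ! i \<in> set (drop i xs)" using xs i by (auto simp: set_drop_eq_image)
        moreover have "xs ! i \<in> V" using xs i by auto
        ultimately have "xs ! i \<in> A (xs ! i) \<inter> set (drop i xs)" using A by blast
        then have d: "0 < real (card (A (xs ! i) \<inter> set (drop i xs)))" (is "0 < ?d")
          by (metis card_gt_0_iff empty_iff finite_Int List.finite_set of_nat_0_less_iff)
        \<comment> \<open>The tangent of \<open>ln\<close> at \<open>K\<close> reduces the mean of \<open>ln d\<close> to that of \<open>1 / d\<close>.\<close>
        have "ln (K / ?d) \<le> K / ?d - 1" using K d by (intro ln_le_minus_one) simp
        moreover have "ln (K / ?d) = ln K - ln ?d" by (subst ln_div) (use K d in auto)
        ultimately show "ln K + (1 - K / ?d) \<le> ln ?d" by linarith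
      qed
      moreover have "(\<Sum>xs\<in>P. K / real (card (A (xs ! i) \<inter> set (drop i xs)))) \<le> card P"
        unfolding P_def K_def n_def using V i c A by (intro sum_inverse_card_suffix) (auto simp: n_def)
      ultimately show "card P * ln (c * real (n - i)) \<le> (\<Sum>xs\<in>P. ln (real (card (A (xs ! i) \<inter> set (drop i xs)))))"
        by (simp add: sum.distrib sum_subtractf K_def)
    qed
    also have "\<dots> = (\<Sum>xs\<in>P. \<Sum>i<n. ln (real (card (A (xs ! i) \<inter> set (drop i xs)))))" by (rule sum.swap)
    also have "\<dots> = (\<Sum>xs\<in>P. swap_entropy E \<phi> xs)"
    proof (rule sum.cong[OF refl])
      fix xs assume "xs \<in> P"
      then have xs: "set xs = V" "length xs = n" by (auto simp: P_def n_def permutations_of_set_def distinct_card)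
      show "(\<Sum>i<n. ln (real (card (A (xs ! i) \<inter> set (drop i xs))))) = swap_entropy E \<phi> xs"
        unfolding swap_entropy_eq_sum A_def xs(2)
        using xs(1) by (intro sum.cong refl) (metis set_drop_subset swaps_restrict)
    qed
    finally show ?thesis .
  qed
  have "card E * (card P * ln (c ^ n * fact n)) \<le> (\<Sum>\<phi>\<in>E. \<Sum>xs\<in>P. swap_entropy E \<phi> xs)"
    using sum_mono[OF low] by simp
  also have "\<dots> = (\<Sum>xs\<in>P. \<Sum>\<phi>\<in>E. swap_entropy E \<phi> xs)" by (rule sum.swap)
  also have "\<dots> \<le> (\<Sum>xs\<in>P. card E * ln (card E))"
  proof (rule sum_mono)
    fix xs assume "xs \<in> P"
    then show "(\<Sum>\<phi>\<in>E. swap_entropy E \<phi> xs) \<le> card E * ln (card E)"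
      using E by (intro swap_entropy_le) (auto simp: P_def permutations_of_set_def)
  qed
  also have "\<dots> = card E * (card P * ln (card E))" by simp
  finally have "ln (c ^ n * fact n) \<le> ln (card E)" using cE cP by simp
  then show ?thesis using pos cE unfolding n_def by (simp only: ln_le_cancel_iff)
qed

text \<open>
  For small \<open>S\<close> the vertices can be freed one at a time: at least \<open>c * |V| / 2\<close> of the swap
  partners of \<open>x\<close> lie outside \<open>S\<close>.
\<close>

lemma card_agree_le_switch:
  fixes c :: real
  assumes E: "finite E" "\<And>\<phi>. \<phi> \<in> E \<Longrightarrow> inj_on \<phi> V" and V: "finite V" and c: "0 < c"
    and sw: "\<And>\<phi> x. \<phi> \<in> E \<Longrightarrow> x \<in> V \<Longrightarrow> c * card V \<le> card (swaps E \<phi> x V)"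
    and S: "S \<subseteq> V" "2 * real (card S) \<le> c * card V"
  shows "card {\<phi> \<in> E. \<forall>x\<in>S. \<phi> x = y x} * (c * card V / 2) ^ card S \<le> card E"
proof -
  have "finite S" using S(1) V finite_subset by blast
  then show ?thesis using S
  proof (induction S rule: finite_induct)
    case empty
    then show ?case by simp
  next
    case (insert x S)
    define E' where "E' = {\<phi> \<in> E. \<forall>x\<in>S. \<phi> x = y x}"
    define F where "F = {\<phi> \<in> E. \<forall>z\<in>insert x S. \<phi> z = y z}"
    have card: "card (insert x S) = Suc (card S)" using insert.hyps by simp
    have many: "c * card V / 2 \<le> card (swaps E' \<phi> x (V - S))" if \<phi>: "\<phi> \<in> F" for \<phi>
    proof -
      have "swaps E \<phi> x V - S \<subseteq> swaps E' \<phi> x (V - S)"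
        using \<phi> insert.hyps(2) by (auto simp: swaps_def E'_def F_def Transposition.transpose_def)
      then have "card (swaps E \<phi> x V - S) \<le> card (swaps E' \<phi> x (V - S))"
        using V by (intro card_mono) auto
      moreover have "card (swaps E \<phi> x V) - card S \<le> card (swaps E \<phi> x V - S)"
        by (rule diff_card_le_card_Diff[OF insert.hyps(1)])
      moreover have "c * card V \<le> card (swaps E \<phi> x V)"
        using \<phi> insert.prems by (intro sw) (auto simp: F_def)
      moreover have "2 * real (card S) \<le> c * card V" using insert.prems card by simp
      ultimately show ?thesis by linarith
    qed
    have "card F * (c * card V / 2) \<le> (\<Sum>\<phi>\<in>F. real (card (swaps E' \<phi> x (V - S))))"
      using sum_mono[OF many] by simp
    also have "\<dots> = real (\<Sum>\<phi>\<in>F. card (swaps E' \<phi> x (V - S)))" by simp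
    also have "(\<Sum>\<phi>\<in>F. card (swaps E' \<phi> x (V - S))) \<le> card E'"
    proof (rule sum_card_swaps_le[where y = "y x"])
      show "inj_on \<phi> (V - S)" if "\<phi> \<in> E'" for \<phi>
        using E(2)[of \<phi>] that by (auto simp: E'_def intro: inj_on_subset)
    qed (use E V insert in \<open>auto simp: E'_def F_def\<close>)
    finally have "card F * (c * card V / 2) \<le> card E'" by simp
    then have "card F * (c * card V / 2) * (c * card V / 2) ^ card S \<le> card E' * (c * card V / 2) ^ card S"
      using c by (intro mult_right_mono) auto
    also have "\<dots> \<le> card E" unfolding E'_def using insert card by simp
    finally show ?case unfolding card F_def[symmetric] by (simp add: mult_ac)
  qed
qed

lemma power_le_exp_fact: "real n ^ n \<le> exp (real n) * fact n"
proof -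
  have "(\<lambda>k. real n ^ k /\<^sub>R fact k) sums exp (real n)" by (rule exp_converges)
  then have "(\<Sum>k\<in>{n}. real n ^ k /\<^sub>R fact k) \<le> exp (real n)"
    by (metis (mono_tags, lifting) sums_unique2 sum_le_suminf finite.emptyI finite.insertI
        scaleR_nonneg_nonneg inverse_nonnegative_iff_nonnegative fact_ge_zero of_nat_0_le_iff
        sums_iff zero_le_power)
  then show ?thesis by (simp add: field_simps)
qed

text \<open>
  The constant \<open>D = (e / c)^(2 / c)\<close> satisfies \<open>(e / c)^|V| \<le> D^|S|\<close> as soon as \<open>|S| \<ge> c |V| / 2\<close>, which
  settles large sets \<open>S\<close>; for small ones \<open>2 / c\<close> would do, and \<open>D\<close> is at least that.
\<close>

theorem many_swaps_imp_vertex_spread: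
  fixes c :: real
  assumes E: "E \<noteq> {}" "E \<subseteq> V \<rightarrow>\<^sub>E W" "\<And>\<phi>. \<phi> \<in> E \<Longrightarrow> inj_on \<phi> V"
    and V: "finite V" "V \<noteq> {}" and W: "finite W" "card W = card V" and c: "0 < c" "c \<le> 1"
    and sw: "\<And>\<phi> x. \<phi> \<in> E \<Longrightarrow> x \<in> V \<Longrightarrow> c * card V \<le> card (swaps E \<phi> x V)"
    and S: "S \<subseteq> V"
  shows "card {\<phi> \<in> E. \<forall>x\<in>S. \<phi> x = y x} \<le> ((exp 1 / c) powr (2 / c) / card V) ^ card S * card E"
proof -
  define n where "n = card V"
  define s where "s = card S"
  define D where "D = (exp 1 / c) powr (2 / c)"
  define F where "F = {\<phi> \<in> E. \<forall>x\<in>S. \<phi> x = y x}"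
  have n: "0 < n" using V by (simp add: n_def card_gt_0_iff)
  have finE: "finite E" using E(2) V W by (meson finite_PiE finite_subset)
  have finS: "finite S" using S V finite_subset by blast
  have sn: "s \<le> n" unfolding s_def n_def using S V by (intro card_mono)
  have e1: "1 \<le> exp (1::real)" by simp
  have "c \<le> exp 1" using c e1 by linarith
  then have ec: "1 \<le> exp 1 / c" using c by (simp only: le_divide_eq_1_pos)
  have e2: "2 \<le> exp (1::real)" using exp_ge_add_one_self[of 1] by simp
  have "2 / c \<le> exp 1 / c" using e2 c by (intro divide_right_mono) auto
  also have "\<dots> = (exp 1 / c) powr 1" using c by simp
  also have "\<dots> \<le> D" unfolding D_def using ec c by (intro powr_mono) auto
  finally have D2: "2 / c \<le> D" .
  have D0: "0 < D" unfolding D_def using c by simp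
  show ?thesis
  proof (cases "2 * real s \<le> c * n")
    case True
    have pos: "0 < c * n / 2" using c n by simp
    have "card F * (c * n / 2) ^ s \<le> card E"
      unfolding F_def n_def s_def
      using finE E V c sw S True by (intro card_agree_le_switch) (auto simp: n_def s_def)
    then have "card F \<le> card E / (c * n / 2) ^ s" using pos by (simp add: pos_le_divide_eq)
    also have "\<dots> = (2 / c / n) ^ s * card E" by (simp add: power_divide power_mult_distrib)
    also have "\<dots> \<le> (D / n) ^ s * card E"
      using D2 c by (intro mult_right_mono power_mono divide_right_mono) auto
    finally show ?thesis by (simp add: F_def D_def n_def s_def)
  next
    case False
    have "card F \<le> card ((V - S) \<rightarrow>\<^sub>E W)"
    proof (rule card_inj_on_le[of "\<lambda>\<phi>. restrict \<phi> (V - S)"])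
      show "inj_on (\<lambda>\<phi>. restrict \<phi> (V - S)) F"
      proof (rule inj_onI, rule ext)
        fix \<phi> \<psi> z assume F: "\<phi> \<in> F" "\<psi> \<in> F" and eq: "restrict \<phi> (V - S) = restrict \<psi> (V - S)"
        consider "z \<in> S" | "z \<in> V - S" | "z \<notin> V" by blast
        then show "\<phi> z = \<psi> z"
        proof cases
          case 1 then show ?thesis using F by (simp add: F_def)
        next
          case 2 then show ?thesis using fun_cong[OF eq, of z] by simp
        next
          case 3
          have "\<phi> \<in> V \<rightarrow>\<^sub>E W" "\<psi> \<in> V \<rightarrow>\<^sub>E W" using F E(2) by (auto simp: F_def)
          then show ?thesis using 3 by (metis PiE_arb)
        qed
      qed
      show "(\<lambda>\<phi>. restrict \<phi> (V - S)) ` F \<subseteq> (V - S) \<rightarrow>\<^sub>E W" using E(2) by (auto simp: F_def PiE_def Pi_def)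
      show "finite ((V - S) \<rightarrow>\<^sub>E W)" using V W by (intro finite_PiE) auto
    qed
    also have "\<dots> = n ^ (n - s)"
      using V W S finS by (simp add: card_PiE card_Diff_subset n_def s_def)
    finally have F: "real (card F) \<le> real n ^ (n - s)" by (metis of_nat_le_iff of_nat_power)
    have many: "c ^ n * fact n \<le> card E"
      unfolding n_def using finE E V c sw by (intro card_ge_of_many_swaps) auto
    have "c ^ n * real n ^ n \<le> c ^ n * (exp (real n) * fact n)"
      using c by (intro mult_left_mono power_le_exp_fact) auto
    also have "\<dots> = exp (real n) * (c ^ n * fact n)" by simp
    also have "\<dots> \<le> exp (real n) * card E" using many by (intro mult_left_mono) auto
    also have "exp (real n) = exp 1 ^ n" using exp_of_nat_mult[of n "1 :: real"] by simp
    finally have "c ^ n * real n ^ n \<le> exp 1 ^ n * card E" .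
    then have *: "real n ^ n \<le> (exp 1 / c) ^ n * card E"
      using c by (simp add: power_divide field_simps)
    have "card F * real n ^ s \<le> real n ^ (n - s) * real n ^ s" by (intro mult_right_mono F) simp
    also have "\<dots> = real n ^ n" using sn by (simp add: power_add[symmetric])
    also have "\<dots> \<le> (exp 1 / c) ^ n * card E" by (rule *)
    also have "\<dots> \<le> D ^ s * card E"
    proof (rule mult_right_mono)
      have "(exp 1 / c) ^ n = (exp 1 / c) powr n" using c by (simp add: powr_realpow)
      also have "\<dots> \<le> (exp 1 / c) powr (2 / c * s)"
        using False c ec by (intro powr_mono) (auto simp: field_simps)
      also have "\<dots> = D powr s" by (simp add: D_def powr_powr)
      also have "\<dots> = D ^ s" using D0 by (simp add: powr_realpow)
      finally show "(exp 1 / c) ^ n \<le> D ^ s" .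
    qed simp
    finally have "card F * real n ^ s \<le> D ^ s * card E" .
    then show ?thesis using n
      by (simp add: F_def D_def n_def[symmetric] s_def[symmetric] power_divide field_simps)
  qed
qed

section \<open>Embeddings into graphs of large minimum degree\<close>

text \<open>
  The neighbourhood of \<open>v\<close>.
\<close>

definition nbrs :: "'a graph \<Rightarrow> 'a \<Rightarrow> 'a set" where
  "nbrs H v = {u. {u, v} \<in> edges H}"

text \<open>
  The vertices not adjacent to \<open>w\<close>; a vertex \<open>w\<close> of a simple graph is one of them.
\<close>

definition non_nbrs :: "'a graph \<Rightarrow> 'a \<Rightarrow> 'a set" where
  "non_nbrs G w = verts G - nbrs G w"

lemma simple_graphD:
  assumes "simple_graph H"
  shows "finite (verts H)" "finite (edges H)" "e \<in> edges H \<Longrightarrow> e \<subseteq> verts H" "e \<in> edges H \<Longrightarrow> card e = 2"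
    "{u} \<notin> edges H" "nbrs H v \<subseteq> verts H"
proof -
  show 1: "finite (verts H)" and 2: "e \<in> edges H \<Longrightarrow> e \<subseteq> verts H" and "e \<in> edges H \<Longrightarrow> card e = 2" for e
    using assms by (auto simp: simple_graph_def)
  have "edges H \<subseteq> Pow (verts H)" using 2 by blast
  then show "finite (edges H)" using 1 by (simp add: finite_subset)
  show "{u} \<notin> edges H" using assms by (auto simp: simple_graph_def)
  show "nbrs H v \<subseteq> verts H" using 2 by (auto simp: nbrs_def)
qed

lemma edge_containing:
  assumes "simple_graph H" "e \<in> edges H" "x \<in> e"
  obtains z where "e = {z, x}" "z \<noteq> x" "z \<in> nbrs H x"
proof -
  have "card e = 2" using assms simple_graphD by blast
  then obtain a b where ab: "e = {a, b}" "a \<noteq> b" by (auto simp: card_2_iff)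
  then consider "x = a" | "x = b" using assms(3) by blast
  then show ?thesis
    using that[of b] that[of a] ab assms(2) by cases (auto simp: nbrs_def insert_commute)
qed

lemma card_nbrs:
  assumes "simple_graph H"
  shows "card (nbrs H v) = degree H v"
proof -
  have "{e \<in> edges H. v \<in> e} = (\<lambda>u. {u, v}) ` nbrs H v"
    using edge_containing[OF assms] by (auto simp: nbrs_def) (metis (no_types, lifting) image_eqI mem_Collect_eq)
  moreover have "inj_on (\<lambda>u. {u, v}) (nbrs H v)" by (auto simp: inj_on_def doubleton_eq_iff)
  ultimately show ?thesis by (simp add: degree_def card_image)
qed

lemma card_non_nbrs:
  assumes "simple_graph G"
  shows "card (non_nbrs G w) = card (verts G) - degree G w"
  unfolding non_nbrs_def using simple_graphD[OF assms] card_nbrs[OF assms]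
  by (metis card_Diff_subset finite_subset)

text \<open>
  The bijections of the vertex sets that map edges to edges, as extensional functions, so that
  they form a finite set.
\<close>

definition embeddings :: "'a graph \<Rightarrow> 'b graph \<Rightarrow> ('a \<Rightarrow> 'b) set" where
  "embeddings H G = {\<phi> \<in> verts H \<rightarrow>\<^sub>E verts G.
     bij_betw \<phi> (verts H) (verts G) \<and> (\<forall>e\<in>edges H. \<phi> ` e \<in> edges G)}"

text \<open>
  The vertices \<open>x'\<close> for which, after exchanging the images of \<open>x\<close> and \<open>x'\<close>, all edges at \<open>x\<close> or \<open>x'\<close> are
  mapped to edges of \<open>G\<close>. Here \<open>\<phi>\<close> may be any bijection.
\<close>

definition good_partners :: "'a graph \<Rightarrow> 'b graph \<Rightarrow> ('a \<Rightarrow> 'b) \<Rightarrow> 'a \<Rightarrow> 'a set" where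
  "good_partners H G \<phi> x =
     {x' \<in> verts H. \<forall>e\<in>edges H. x \<in> e \<or> x' \<in> e \<longrightarrow> (\<phi> \<circ> switch x x') ` e \<in> edges G}"

text \<open>
  A vertex \<open>x'\<close> can only be bad if its image is no neighbour of the image of a neighbour of \<open>x\<close>, or if it
  is a neighbour of a vertex whose image is no neighbour of that of \<open>x\<close>. Each case excludes at most \<open>d * b\<close>
  vertices. Neighbours of \<open>x\<close> itself are excluded by the first case, since no vertex is adjacent to itself.
\<close>

lemma card_good_partners:
  fixes b :: real
  assumes H: "simple_graph H" "\<And>v. v \<in> verts H \<Longrightarrow> degree H v \<le> d"
    and G: "simple_graph G" "\<And>w. w \<in> verts G \<Longrightarrow> card (non_nbrs G w) \<le> b"
    and \<phi>: "bij_betw \<phi> (verts H) (verts G)" and x: "x \<in> verts H"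
  shows "real (card (verts H)) - 2 * d * b \<le> card (good_partners H G \<phi> x)"
proof -
  let ?V = "verts H"
  define pre where "pre w = {z \<in> ?V. \<phi> z \<in> non_nbrs G w}" for w
  define B1 where "B1 = (\<Union>z\<in>nbrs H x. pre (\<phi> z))"
  define B2 where "B2 = (\<Union>z\<in>pre (\<phi> x). nbrs H z)"
  have fV: "finite ?V" using simple_graphD(1)[OF H(1)] .
  have fn: "finite (nbrs H v)" for v using simple_graphD(6)[OF H(1)] fV finite_subset by blast
  have fp: "finite (pre w)" for w using fV by (simp add: pre_def)
  have \<phi>V: "\<phi> z \<in> verts G" if "z \<in> ?V" for z using \<phi> that by (auto simp: bij_betw_def)
  have cn: "real (card (nbrs H v)) \<le> d" if "v \<in> ?V" for v using H(2)[OF that] card_nbrs[OF H(1)] by simp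
  have cp: "real (card (pre w)) \<le> b" if "w \<in> verts G" for w
  proof -
    have "card (pre w) \<le> card (non_nbrs G w)"
      using \<phi> simple_graphD(1)[OF G(1)]
      by (intro card_inj_on_le[of \<phi>]) (auto simp: pre_def non_nbrs_def bij_betw_def intro: inj_on_subset)
    then show ?thesis using G(2)[OF that] by linarith
  qed
  have b0: "0 \<le> b" using cp[OF \<phi>V[OF x]] by linarith
  have "real (card B1) \<le> (\<Sum>z\<in>nbrs H x. real (card (pre (\<phi> z))))"
    unfolding B1_def of_nat_sum[symmetric] of_nat_le_iff by (rule card_UN_le[OF fn])
  also have "\<dots> \<le> (\<Sum>z\<in>nbrs H x. b)"
    using simple_graphD(6)[OF H(1)] by (intro sum_mono cp \<phi>V) auto
  also have "\<dots> \<le> d * b" using cn[OF x] b0 by (simp add: mult_right_mono)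
  finally have B1: "real (card B1) \<le> d * b" .
  have "real (card B2) \<le> (\<Sum>z\<in>pre (\<phi> x). real (card (nbrs H z)))"
    unfolding B2_def of_nat_sum[symmetric] of_nat_le_iff by (rule card_UN_le[OF fp])
  also have "\<dots> \<le> (\<Sum>z\<in>pre (\<phi> x). d)" by (simp only: of_nat_sum) (intro sum_mono cn, auto simp: pre_def)
  also have "\<dots> = real d * real (card (pre (\<phi> x)))" by simp
  also have "\<dots> \<le> d * b" by (intro mult_left_mono cp \<phi>V x) simp
  finally have B2: "real (card B2) \<le> d * b" .
  have good: "?V - (B1 \<union> B2) \<subseteq> good_partners H G \<phi> x"
  proof
    fix x' assume x': "x' \<in> ?V - (B1 \<union> B2)"
    have i: "{\<phi> z, \<phi> x'} \<in> edges G" if z: "z \<in> nbrs H x" for z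
      using x' z \<phi>V by (auto simp: B1_def pre_def non_nbrs_def nbrs_def insert_commute)
    have ii: "{\<phi> z, \<phi> x} \<in> edges G" if z: "z \<in> nbrs H x'" for z
    proof -
      have "z \<in> ?V" using z simple_graphD(6)[OF H(1)] by blast
      moreover have "x' \<in> nbrs H z" using z by (simp add: nbrs_def insert_commute)
      ultimately show ?thesis using x' \<phi>V by (auto simp: B2_def pre_def non_nbrs_def nbrs_def)
    qed
    have nadj: "x' \<notin> nbrs H x" using i simple_graphD(5)[OF G(1)] by fastforce
    then have nadj': "x \<notin> nbrs H x'" by (simp add: nbrs_def insert_commute)
    have "(\<phi> \<circ> switch x x') ` e \<in> edges G" if e: "e \<in> edges H" "x \<in> e \<or> x' \<in> e" for e
      using e(2)
    proof
      assume "x \<in> e"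
      then obtain z where z: "e = {z, x}" "z \<noteq> x" "z \<in> nbrs H x" using edge_containing[OF H(1) e(1)] by metis
      then have "z \<noteq> x'" using nadj by blast
      then show ?thesis using z i by simp
    next
      assume "x' \<in> e"
      then obtain z where z: "e = {z, x'}" "z \<noteq> x'" "z \<in> nbrs H x'" using edge_containing[OF H(1) e(1)] by metis
      then have "z \<noteq> x" using nadj' by blast
      then show ?thesis using z ii by simp
    qed
    then show "x' \<in> good_partners H G \<phi> x" using x' by (auto simp: good_partners_def)
  qed
  have "card (B1 \<union> B2) \<le> card B1 + card B2" by (rule card_Un_le)
  moreover have "finite (B1 \<union> B2)" using fn fp by (simp add: B1_def B2_def)
  then have "card ?V - card (B1 \<union> B2) \<le> card (?V - (B1 \<union> B2))" by (rule diff_card_le_card_Diff)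
  moreover have "card (?V - (B1 \<union> B2)) \<le> card (good_partners H G \<phi> x)"
    using good fV by (intro card_mono) (auto simp: good_partners_def)
  ultimately show ?thesis using B1 B2 by (simp add: algebra_simps)
qed

lemma switch_bij:
  assumes "bij_betw \<phi> V W" "\<phi> \<in> V \<rightarrow>\<^sub>E W" "x \<in> V" "x' \<in> V"
  shows "bij_betw (\<phi> \<circ> switch x x') V W" "\<phi> \<circ> switch x x' \<in> V \<rightarrow>\<^sub>E W"
proof -
  have "bij_betw (switch x x') V V" using assms by (simp add: bij_betw_transpose_iff)
  then show "bij_betw (\<phi> \<circ> switch x x') V W" using assms(1) bij_betw_trans by blast
  show "\<phi> \<circ> switch x x' \<in> V \<rightarrow>\<^sub>E W"
    using assms by (auto simp: PiE_def Pi_def extensional_def Transposition.transpose_def)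
qed

lemma switch_image_other: "x \<notin> e \<Longrightarrow> x' \<notin> e \<Longrightarrow> (\<phi> \<circ> switch x x') ` e = \<phi> ` e"
  by (intro image_cong) (auto simp: Transposition.transpose_def)

lemma good_partners_subset_swaps:
  assumes "\<phi> \<in> embeddings H G" "x \<in> verts H"
  shows "good_partners H G \<phi> x \<subseteq> swaps (embeddings H G) \<phi> x (verts H)"
proof
  fix x' assume x': "x' \<in> good_partners H G \<phi> x"
  then have V: "x' \<in> verts H" by (simp add: good_partners_def)
  have \<phi>: "bij_betw \<phi> (verts H) (verts G)" "\<phi> \<in> verts H \<rightarrow>\<^sub>E verts G" "\<And>e. e \<in> edges H \<Longrightarrow> \<phi> ` e \<in> edges G"
    using assms by (auto simp: embeddings_def)
  have "(\<phi> \<circ> switch x x') ` e \<in> edges G" if "e \<in> edges H" for e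
  proof (cases "x \<in> e \<or> x' \<in> e")
    case True then show ?thesis using x' that by (auto simp: good_partners_def)
  next
    case False then show ?thesis using \<phi>(3)[OF that] switch_image_other[of x e x' \<phi>] by simp
  qed
  then show "x' \<in> swaps (embeddings H G) \<phi> x (verts H)"
    using switch_bij[OF \<phi>(1,2) assms(2) V] V by (simp add: swaps_def embeddings_def)
qed

text \<open>
  A bijection that maps the fewest edges badly is an embedding: swapping an end of a bad edge with a good
  partner repairs that edge and spoils no other.
\<close>

lemma embeddings_nonempty:
  fixes b :: real
  assumes H: "simple_graph H" "\<And>v. v \<in> verts H \<Longrightarrow> degree H v \<le> d"
    and G: "simple_graph G" "\<And>w. w \<in> verts G \<Longrightarrow> card (non_nbrs G w) \<le> b"
    and n: "card (verts G) = card (verts H)" and small: "2 * d * b < card (verts H)"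
  shows "embeddings H G \<noteq> {}"
proof -
  define P where "P \<phi> \<longleftrightarrow> \<phi> \<in> verts H \<rightarrow>\<^sub>E verts G \<and> bij_betw \<phi> (verts H) (verts G)" for \<phi>
  define bad where "bad \<phi> = {e \<in> edges H. \<phi> ` e \<notin> edges G}" for \<phi>
  obtain f where f: "bij_betw f (verts H) (verts G)"
    using finite_same_card_bij simple_graphD(1)[OF H(1)] simple_graphD(1)[OF G(1)] n by metis
  have Pf: "P (restrict f (verts H))"
    using f by (auto simp: P_def bij_betw_def inj_on_def)
  define \<phi> where "\<phi> = arg_min (\<lambda>\<phi>. card (bad \<phi>)) P"
  have \<phi>: "P \<phi>" unfolding \<phi>_def by (rule arg_min_natI[where P = P, OF Pf])
  have min: "card (bad \<phi>) \<le> card (bad \<psi>)" if "P \<psi>" for \<psi>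
    unfolding \<phi>_def by (rule arg_min_nat_le[where P = P, OF that])
  have "bad \<phi> = {}"
  proof (rule ccontr)
    assume "bad \<phi> \<noteq> {}"
    then obtain e where e: "e \<in> edges H" "\<phi> ` e \<notin> edges G" by (auto simp: bad_def)
    then obtain x where x: "x \<in> e" using simple_graphD(4)[OF H(1), of e] by fastforce
    then have xV: "x \<in> verts H" using simple_graphD(3)[OF H(1) e(1)] by blast
    have "0 < real (card (good_partners H G \<phi> x))"
      using card_good_partners[OF H G, of \<phi> x] \<phi> xV small by (simp add: P_def)
    then obtain x' where x': "x' \<in> good_partners H G \<phi> x"
      by (metis card.empty equals0I of_nat_0 less_irrefl)
    define \<psi> where "\<psi> = \<phi> \<circ> switch x x'"
    have "P \<psi>" unfolding \<psi>_def P_def using switch_bij[of \<phi> "verts H" "verts G" x x'] \<phi> xV x'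
      by (auto simp: P_def good_partners_def)
    then have "card (bad \<phi>) \<le> card (bad \<psi>)" by (rule min)
    moreover have "bad \<psi> \<subset> bad \<phi>"
    proof
      show "bad \<psi> \<subseteq> bad \<phi>"
      proof
        fix e' assume e': "e' \<in> bad \<psi>"
        then have "x \<notin> e'" "x' \<notin> e'" using x' by (auto simp: bad_def \<psi>_def good_partners_def)
        then show "e' \<in> bad \<phi>" using e' switch_image_other[of x e' x' \<phi>] by (simp add: bad_def \<psi>_def)
      qed
      have "e \<notin> bad \<psi>" using x' x e by (auto simp: bad_def \<psi>_def good_partners_def)
      then show "bad \<psi> \<noteq> bad \<phi>" using e by (auto simp: bad_def)
    qed
    then have "card (bad \<psi>) < card (bad \<phi>)"
      using simple_graphD(2)[OF H(1)] by (intro psubset_card_mono) (auto simp: bad_def)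
    ultimately show False by simp
  qed
  then have "\<phi> \<in> embeddings H G" using \<phi> by (auto simp: bad_def P_def embeddings_def)
  then show ?thesis by blast
qed

section \<open>From vertex spread to edge spread\<close>

text \<open>
  The injective homomorphisms into \<open>H\<close> from the graph with edge set \<open>U\<close> and no isolated vertices.
\<close>

definition homs :: "'b set set \<Rightarrow> 'a graph \<Rightarrow> ('b \<Rightarrow> 'a) set" where
  "homs U H = {\<psi> \<in> \<Union>U \<rightarrow>\<^sub>E verts H. inj_on \<psi> (\<Union>U) \<and> (\<forall>e\<in>U. \<psi> ` e \<in> edges H)}"

lemma d1_le_m1:
  assumes H: "simple_graph H" and F: "subgraph F H" "card (verts F) \<ge> 2"
  shows "d1 F \<le> m1 H"
  unfolding m1_def
proof (rule Max_ge)
  have "{F. subgraph F H \<and> card (verts F) \<ge> 2} \<subseteq> (\<lambda>(V, E). Graph V E) ` (Pow (verts H) \<times> Pow (edges H))"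
  proof
    fix K assume "K \<in> {F. subgraph F H \<and> card (verts F) \<ge> 2}"
    then show "K \<in> (\<lambda>(V, E). Graph V E) ` (Pow (verts H) \<times> Pow (edges H))"
      by (cases K) (auto simp: subgraph_def)
  qed
  then have "finite {F. subgraph F H \<and> card (verts F) \<ge> 2}"
    using simple_graphD(1,2)[OF H] by (meson finite_Pow_iff finite_SigmaI finite_imageI finite_subset)
  then show "finite {d1 F |F. subgraph F H \<and> card (verts F) \<ge> 2}" by simp
qed (use F in blast)

text \<open>
  Split off a union of connected components at a time. Among the vertex sets \<open>A\<close> containing a given vertex \<open>a\<close> for which
  the homomorphisms have at most \<open>n * d^(|A| - 1)\<close> restrictions to \<open>A\<close>, a maximal one is a union of
  components, because a vertex joined to \<open>A\<close> by an edge has at most \<open>d\<close> possible images given those on \<open>A\<close>.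
  The edges inside \<open>A\<close> are embedded in \<open>H\<close>, so there are at most \<open>m1 H * (|A| - 1)\<close> of them.
\<close>

lemma card_homs_le:
  fixes d :: nat
  assumes H: "simple_graph H" "\<And>v. v \<in> verts H \<Longrightarrow> degree H v \<le> d" and d: "1 \<le> d"
    and m: "0 < m1 H" and n: "verts H \<noteq> {}"
    and U: "finite U" "\<And>e. e \<in> U \<Longrightarrow> card e = 2"
  shows "card (homs U H) \<le> real d ^ card (\<Union>U) *
    real (card (verts H)) powr (real (card (\<Union>U)) - real (card U) / m1 H)"
  using U
proof (induction U rule: finite_psubset_induct)
  case (psubset U)
  define n where "n = real (card (verts H))"
  have fV: "finite (verts H)" using simple_graphD(1)[OF H(1)] .
  have n1: "1 \<le> n" using fV assms(5) by (simp add: n_def Suc_le_eq card_gt_0_iff)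
  have fe: "finite e" if "e \<in> U" for e using psubset.prems[OF that] by (metis card.infinite zero_neq_numeral)
  have fUU: "finite (\<Union>U)" using fe psubset.hyps by blast
  have fhoms: "finite (homs U' H)" if "U' \<subseteq> U" for U'
  proof (rule finite_subset)
    show "homs U' H \<subseteq> \<Union>U' \<rightarrow>\<^sub>E verts H" by (auto simp: homs_def)
    have "finite (\<Union>U')" by (rule finite_subset[OF _ fUU]) (use that in blast)
    then show "finite (\<Union>U' \<rightarrow>\<^sub>E verts H)" using fV by (intro finite_PiE) auto
  qed
  show ?case unfolding n_def[symmetric]
  proof (cases "U = {} \<or> homs U H = {}")
    case True
    then show "card (homs U H) \<le> real d ^ card (\<Union>U) * n powr (real (card (\<Union>U)) - real (card U) / m1 H)"
    proof
      assume "U = {}"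
      then have "homs U H = {\<lambda>x. undefined}" by (auto simp: homs_def)
      then show ?thesis using n1 \<open>U = {}\<close> by simp
    qed simp
  next
    case False
    then obtain \<psi>0 e0 where \<psi>0: "\<psi>0 \<in> homs U H" and e0: "e0 \<in> U" by blast
    obtain a where a: "a \<in> e0" using psubset.prems[OF e0] by fastforce
    define R where "R A = (\<lambda>\<psi>. restrict \<psi> A) ` homs U H" for A
    define \<A> where "\<A> = {A. A \<subseteq> \<Union>U \<and> a \<in> A \<and> real (card (R A)) \<le> n * real d ^ (card A - 1)}"
    have finR: "finite (R A)" for A using fhoms by (simp add: R_def)
    have "card (R {a}) \<le> card ({a} \<rightarrow>\<^sub>E verts H)"
    proof (rule card_mono)
      show "finite ({a} \<rightarrow>\<^sub>E verts H)" using fV by (intro finite_PiE) auto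
      show "R {a} \<subseteq> {a} \<rightarrow>\<^sub>E verts H"
        using a e0 by (auto simp: R_def homs_def PiE_iff extensional_def split: if_splits)
    qed
    then have "{a} \<in> \<A>" using a e0 by (auto simp: \<A>_def card_PiE n_def)
    moreover have "finite \<A>" using fUU by (simp add: \<A>_def)
    ultimately obtain A where A: "A \<in> \<A>" and Amax: "\<And>A'. A' \<in> \<A> \<Longrightarrow> A \<subseteq> A' \<Longrightarrow> A = A'"
      using finite_has_maximal[of \<A>] by blast
    have AU: "A \<subseteq> \<Union>U" and aA: "a \<in> A" and RA: "real (card (R A)) \<le> n * real d ^ (card A - 1)"
      using A by (auto simp: \<A>_def)
    have finA: "finite A" using AU fUU finite_subset by blast
    have cA: "1 \<le> card A" using aA finA by (simp add: Suc_le_eq card_gt_0_iff) blast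
    have closed: "e \<subseteq> A" if e: "e \<in> U" and meets: "e \<inter> A \<noteq> {}" for e
    proof (rule ccontr)
      assume "\<not> e \<subseteq> A"
      then obtain u w where uw: "u \<in> e" "u \<in> A" "w \<in> e" "w \<notin> A" using meets by blast
      then have eq: "e = {u, w}" using psubset.prems[OF e] fe[OF e]
        by (metis card_2_iff doubleton_eq_iff insertE singletonD)
      have "card (R (insert w A)) \<le> card (Sigma (R A) (\<lambda>g. nbrs H (g u)))"
      proof (rule card_inj_on_le[of "\<lambda>h. (restrict h A, h w)"])
        show "inj_on (\<lambda>h. (restrict h A, h w)) (R (insert w A))"
        proof (rule inj_onI, rule ext)
          fix g h z assume gh: "g \<in> R (insert w A)" "h \<in> R (insert w A)"
            and eq: "(restrict g A, g w) = (restrict h A, h w)"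
          have "restrict g A z = restrict h A z" "g w = h w" using eq by auto
          then show "g z = h z" using gh by (cases "z = w"; cases "z \<in> A") (auto simp: R_def)
        qed
        show "(\<lambda>h. (restrict h A, h w)) ` R (insert w A) \<subseteq> Sigma (R A) (\<lambda>g. nbrs H (g u))"
        proof
          fix z assume "z \<in> (\<lambda>h. (restrict h A, h w)) ` R (insert w A)"
          then obtain \<psi> where \<psi>: "\<psi> \<in> homs U H"
            and z: "z = (restrict (restrict \<psi> (insert w A)) A, restrict \<psi> (insert w A) w)"
            by (auto simp: R_def)
          have "restrict (restrict \<psi> (insert w A)) A = restrict \<psi> A" by (rule ext) auto
          moreover have "\<psi> ` e \<in> edges H" using \<psi> e by (simp add: homs_def)
          then have "\<psi> w \<in> nbrs H (\<psi> u)" by (simp add: eq nbrs_def insert_commute)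
          ultimately show "z \<in> Sigma (R A) (\<lambda>g. nbrs H (g u))" using \<psi> uw z by (auto simp: R_def)
        qed
        show "finite (Sigma (R A) (\<lambda>g. nbrs H (g u)))"
          using finR simple_graphD(6)[OF H(1)] fV by (meson finite_SigmaI finite_subset)
      qed
      also have "\<dots> = (\<Sum>g\<in>R A. card (nbrs H (g u)))"
        using finR simple_graphD(6)[OF H(1)] fV by (subst card_SigmaI) (auto intro: finite_subset)
      also have "\<dots> \<le> (\<Sum>g\<in>R A. d)"
      proof (rule sum_mono)
        fix g assume "g \<in> R A"
        then have "g u \<in> verts H" using uw e by (auto simp: R_def homs_def)
        then show "card (nbrs H (g u)) \<le> d" using H(2) card_nbrs[OF H(1)] by simp
      qed
      finally have "card (R (insert w A)) \<le> card (R A) * d" by simp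
      then have "real (card (R (insert w A))) \<le> real (card (R A)) * real d" by (metis of_nat_le_iff of_nat_mult)
      also have "\<dots> \<le> n * real d ^ (card A - 1) * real d" using RA by (intro mult_right_mono) auto
      also have "\<dots> = n * real d ^ (card (insert w A) - 1)"
        using uw finA cA by (simp add: power_Suc2[symmetric] del: power_Suc)
      finally have "insert w A \<in> \<A>" using AU aA uw e by (auto simp: \<A>_def)
      then show False using Amax uw by blast
    qed
    define U1 where "U1 = {e \<in> U. e \<subseteq> A}"
    define U2 where "U2 = U - U1"
    have e0A: "e0 \<subseteq> A" using closed[OF e0] a aA by blast
    have disj: "e \<inter> A = {}" if "e \<in> U2" for e using that closed by (auto simp: U2_def U1_def)
    have UU: "\<Union>U = A \<union> \<Union>U2"
    proof
      show "\<Union>U \<subseteq> A \<union> \<Union>U2" by (auto simp: U2_def U1_def)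
    qed (use AU in \<open>auto simp: U2_def\<close>)
    have fU: "finite U1" "finite U2" using psubset.hyps by (auto simp: U1_def U2_def)
    have finU2: "finite (\<Union>U2)" using UU fUU by (metis finite_Un)
    have v: "card (\<Union>U) = card A + card (\<Union>U2)"
      unfolding UU using finA finU2 disj by (intro card_Un_disjoint) auto
    have e: "card U = card U1 + card U2"
    proof -
      have "U = U1 \<union> U2" "U1 \<inter> U2 = {}" by (auto simp: U1_def U2_def)
      then show ?thesis using card_Un_disjoint[OF fU] by simp
    qed
    have dens: "real (card U1) / m1 H \<le> real (card A) - 1"
    proof -
      define F where "F = Graph (\<psi>0 ` A) ((`) \<psi>0 ` U1)"
      have inj: "inj_on \<psi>0 (\<Union>U)" using \<psi>0 by (simp add: homs_def)
      have cF: "card (verts F) = card A" using inj_on_subset[OF inj AU] by (simp add: F_def card_image)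
      have "card ((`) \<psi>0 ` U1) = card U1"
        by (intro card_image inj_on_image inj_on_subset[OF inj]) (auto simp: U1_def)
      then have eF: "card (edges F) = card U1" by (simp add: F_def)
      have "card (\<psi>0 ` e) = 2" if "e \<in> U" for e
        using psubset.prems[OF that] inj_on_subset[OF inj, of e] that by (subst card_image) auto
      then have "simple_graph F" using finA by (auto simp: simple_graph_def F_def U1_def)
      then have "subgraph F H" using \<psi>0 AU by (auto simp: subgraph_def F_def U1_def homs_def)
      moreover have "2 \<le> card A" using card_mono[OF finA e0A] psubset.prems[OF e0] by simp
      ultimately have "d1 F \<le> m1 H" using cF by (intro d1_le_m1[OF H(1)]) auto
      then show ?thesis using \<open>2 \<le> card A\<close> m by (simp add: d1_def cF eF field_simps)
    qed
    have "card (homs U H) \<le> card (R A \<times> homs U2 H)"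
    proof (rule card_inj_on_le[of "\<lambda>\<psi>. (restrict \<psi> A, restrict \<psi> (\<Union>U2))"])
      show "inj_on (\<lambda>\<psi>. (restrict \<psi> A, restrict \<psi> (\<Union>U2))) (homs U H)"
      proof (rule inj_onI, rule ext)
        fix g h z assume gh: "g \<in> homs U H" "h \<in> homs U H"
          and eq: "(restrict g A, restrict g (\<Union>U2)) = (restrict h A, restrict h (\<Union>U2))"
        have 1: "restrict g A z = restrict h A z" "restrict g (\<Union>U2) z = restrict h (\<Union>U2) z"
          using eq by auto
        consider "z \<in> A" | "z \<in> \<Union>U2" | "z \<notin> \<Union>U" using UU by blast
        then show "g z = h z"
        proof cases
          case 1 then show ?thesis using \<open>restrict g A z = restrict h A z\<close> by simp
        next
          case 2 then show ?thesis using \<open>restrict g (\<Union>U2) z = restrict h (\<Union>U2) z\<close> by simp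
        next
          case 3
          have "g \<in> \<Union>U \<rightarrow>\<^sub>E verts H" "h \<in> \<Union>U \<rightarrow>\<^sub>E verts H" using gh by (auto simp: homs_def)
          then show ?thesis using 3 by (metis PiE_arb)
        qed
      qed
      show "(\<lambda>\<psi>. (restrict \<psi> A, restrict \<psi> (\<Union>U2))) ` homs U H \<subseteq> R A \<times> homs U2 H"
      proof
        fix z assume "z \<in> (\<lambda>\<psi>. (restrict \<psi> A, restrict \<psi> (\<Union>U2))) ` homs U H"
        then obtain \<psi> where \<psi>: "\<psi> \<in> homs U H" and z: "z = (restrict \<psi> A, restrict \<psi> (\<Union>U2))" by blast
        have sub: "\<Union>U2 \<subseteq> \<Union>U" by (auto simp: U2_def)
        have "restrict \<psi> (\<Union>U2) ` e = \<psi> ` e" if "e \<in> U2" for e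
          using that by (intro image_cong) auto
        moreover have "\<psi> ` e \<in> edges H" if "e \<in> U2" for e using \<psi> that by (auto simp: homs_def U2_def)
        moreover have "inj_on \<psi> (\<Union>U2)" using \<psi> inj_on_subset[OF _ sub] by (auto simp: homs_def)
        moreover have "restrict \<psi> (\<Union>U2) \<in> \<Union>U2 \<rightarrow>\<^sub>E verts H" using \<psi> sub by (auto simp: homs_def)
        ultimately have "restrict \<psi> (\<Union>U2) \<in> homs U2 H" by (simp add: homs_def)
        then show "z \<in> R A \<times> homs U2 H" using z \<psi> by (auto simp: R_def)
      qed
      show "finite (R A \<times> homs U2 H)" using finR fhoms[of U2] by (auto simp: U2_def)
    qed
    then have "real (card (homs U H)) \<le> real (card (R A)) * real (card (homs U2 H))"
      by (simp add: card_cartesian_product flip: of_nat_mult)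
    also have "\<dots> \<le> (n * real d ^ (card A - 1)) *
        (real d ^ card (\<Union>U2) * n powr (real (card (\<Union>U2)) - real (card U2) / m1 H))"
    proof (intro mult_mono RA)
      have "U2 \<subset> U" using e0 e0A by (auto simp: U2_def U1_def)
      then show "real (card (homs U2 H)) \<le> real d ^ card (\<Union>U2) * n powr (real (card (\<Union>U2)) - real (card U2) / m1 H)"
        unfolding n_def using psubset.prems by (intro psubset.IH) auto
    qed (use n1 in auto)
    also have "\<dots> = real d ^ (card A - 1 + card (\<Union>U2)) * n powr (1 + (real (card (\<Union>U2)) - real (card U2) / m1 H))"
      using n1 by (simp add: power_add powr_add)
    also have "\<dots> \<le> real d ^ card (\<Union>U) * n powr (real (card (\<Union>U)) - real (card U) / m1 H)"
    proof (intro mult_mono power_increasing powr_mono)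
      show "1 + (real (card (\<Union>U2)) - real (card U2) / m1 H) \<le> real (card (\<Union>U)) - real (card U) / m1 H"
        using dens by (simp add: v e add_divide_distrib)
    qed (use d n1 v in auto)
    finally show "card (homs U H) \<le> real d ^ card (\<Union>U) * n powr (real (card (\<Union>U)) - real (card U) / m1 H)" .
  qed
qed

text \<open>
  If the image of \<open>H\<close> contains \<open>U\<close>, then the inverse of \<open>\<phi>\<close> restricts to a homomorphism from \<open>U\<close> into \<open>H\<close>.
  For each fixed homomorphism vertex spread applies to the vertices of \<open>U\<close>, at most \<open>2 * |U|\<close> in number.
\<close>

lemma vertex_spread_imp_spread:
  fixes D :: real and d :: nat
  assumes H: "simple_graph H" "\<And>v. v \<in> verts H \<Longrightarrow> degree H v \<le> d" and d: "1 \<le> d"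
    and m: "0 < m1 H" and n: "verts H \<noteq> {}" and G: "simple_graph G" and D: "1 \<le> D"
    and E: "E \<subseteq> embeddings H G" "finite E"
    and spread: "\<And>S y. S \<subseteq> verts H \<Longrightarrow>
      card {\<phi> \<in> E. \<forall>x\<in>S. \<phi> x = y x} \<le> (D / card (verts H)) ^ card S * card E"
    and U: "U \<subseteq> edges G"
  shows "card {\<phi> \<in> E. U \<subseteq> (`) \<phi> ` edges H}
    \<le> ((D * d)\<^sup>2 * card (verts H) powr (- 1 / m1 H)) ^ card U * card E"
proof -
  define n where "n = real (card (verts H))"
  define v where "v = card (\<Union>U)"
  have fU: "finite U" using U simple_graphD(2)[OF G] finite_subset by blast
  have c2: "card e = 2" if "e \<in> U" for e using U that simple_graphD(4)[OF G] by blast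
  have UV: "\<Union>U \<subseteq> verts G" using U simple_graphD(3)[OF G] by blast
  have fUU: "finite (\<Union>U)" using UV simple_graphD(1)[OF G] finite_subset by blast
  have fV: "finite (verts H)" using simple_graphD(1)[OF H(1)] .
  have n0: "1 \<le> n" using fV assms(5) by (simp add: n_def Suc_le_eq card_gt_0_iff)
  have fhoms: "finite (homs U H)"
  proof (rule finite_subset)
    show "homs U H \<subseteq> \<Union>U \<rightarrow>\<^sub>E verts H" by (auto simp: homs_def)
    show "finite (\<Union>U \<rightarrow>\<^sub>E verts H)" using fV fUU by (intro finite_PiE) auto
  qed
  define P where "P \<psi> = {\<phi> \<in> E. \<forall>x\<in>\<psi> ` \<Union>U. \<phi> x = inv_into (\<Union>U) \<psi> x}" for \<psi>
  have cover: "{\<phi> \<in> E. U \<subseteq> (`) \<phi> ` edges H} \<subseteq> (\<Union>\<psi>\<in>homs U H. P \<psi>)"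
  proof
    fix \<phi> assume "\<phi> \<in> {\<phi> \<in> E. U \<subseteq> (`) \<phi> ` edges H}"
    then have \<phi>: "\<phi> \<in> E" "U \<subseteq> (`) \<phi> ` edges H" by auto
    have bij: "bij_betw \<phi> (verts H) (verts G)" using \<phi> E by (auto simp: embeddings_def)
    then have inj: "inj_on \<phi> (verts H)" and im: "\<phi> ` verts H = verts G" by (auto simp: bij_betw_def)
    define \<psi> where "\<psi> = restrict (inv_into (verts H) \<phi>) (\<Union>U)"
    have inj\<psi>: "inj_on \<psi> (\<Union>U)"
      unfolding \<psi>_def using UV im by (auto simp: inj_on_restrict_eq intro: inj_on_inv_into)
    have "\<psi> ` e \<in> edges H" if e: "e \<in> U" for e
    proof -
      obtain f where f: "f \<in> edges H" "e = \<phi> ` f" using \<phi>(2) e by blast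
      have "\<psi> ` e = inv_into (verts H) \<phi> ` e" unfolding \<psi>_def using e by (intro image_cong) auto
      also have "\<dots> = f" unfolding f(2) using simple_graphD(3)[OF H(1) f(1)] inj by (rule inv_into_image_cancel[rotated])
      finally show ?thesis using f(1) by simp
    qed
    moreover have "\<psi> \<in> \<Union>U \<rightarrow>\<^sub>E verts H" unfolding \<psi>_def using UV im by (auto intro!: inv_into_into)
    ultimately have "\<psi> \<in> homs U H" using inj\<psi> by (simp add: homs_def)
    moreover have "\<phi> (\<psi> w) = inv_into (\<Union>U) \<psi> (\<psi> w)" if w: "w \<in> \<Union>U" for w
    proof -
      have "inv_into (\<Union>U) \<psi> (\<psi> w) = w" by (rule inv_into_f_f[OF inj\<psi> w])
      moreover have "w \<in> \<phi> ` verts H" using w UV im by blast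
      then have "\<phi> (\<psi> w) = w" unfolding \<psi>_def restrict_apply'[OF w] by (rule f_inv_into_f)
      ultimately show ?thesis by simp
    qed
    ultimately show "\<phi> \<in> (\<Union>\<psi>\<in>homs U H. P \<psi>)" using \<phi>(1) by (auto simp: P_def)
  qed
  have "card {\<phi> \<in> E. U \<subseteq> (`) \<phi> ` edges H} \<le> card (\<Union>\<psi>\<in>homs U H. P \<psi>)"
    using cover fhoms E(2) by (intro card_mono) (auto simp: P_def)
  also have "\<dots> \<le> (\<Sum>\<psi>\<in>homs U H. card (P \<psi>))" by (rule card_UN_le[OF fhoms])
  finally have "real (card {\<phi> \<in> E. U \<subseteq> (`) \<phi> ` edges H}) \<le> (\<Sum>\<psi>\<in>homs U H. real (card (P \<psi>)))"
    unfolding of_nat_sum[symmetric] of_nat_le_iff .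
  also have "\<dots> \<le> (\<Sum>\<psi>\<in>homs U H. (D / n) ^ v * card E)"
  proof (rule sum_mono)
    fix \<psi> assume \<psi>: "\<psi> \<in> homs U H"
    then have "card (\<psi> ` \<Union>U) = v" unfolding v_def by (intro card_image) (simp add: homs_def)
    moreover have "\<psi> ` \<Union>U \<subseteq> verts H" using \<psi> by (auto simp: homs_def)
    ultimately show "real (card (P \<psi>)) \<le> (D / n) ^ v * card E"
      using spread[of "\<psi> ` \<Union>U" "inv_into (\<Union>U) \<psi>"] by (simp add: P_def n_def)
  qed
  also have "\<dots> = card (homs U H) * ((D / n) ^ v * card E)" by simp
  also have "\<dots> \<le> (real d ^ v * n powr (real v - real (card U) / m1 H)) * ((D / n) ^ v * card E)"
    unfolding v_def n_def using card_homs_le[OF H d m n fU c2] D by (intro mult_right_mono) auto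
  also have "\<dots> = (D * d) ^ v * n powr (- real (card U) / m1 H) * card E"
  proof -
    have "n powr (real v - real (card U) / m1 H) = n ^ v * n powr (- real (card U) / m1 H)"
      using n0 powr_add[of n "real v" "- real (card U) / m1 H"] by (simp add: powr_realpow)
    then have "(real d ^ v * n powr (real v - real (card U) / m1 H)) * ((D / n) ^ v * card E)
        = (n ^ v * (D / n) ^ v) * real d ^ v * n powr (- real (card U) / m1 H) * card E"
      by (simp only: mult_ac)
    also have "n ^ v * (D / n) ^ v = D ^ v" using n0 by (simp add: power_divide)
    finally show ?thesis by (simp only: power_mult_distrib)
  qed
  also have "\<dots> \<le> (D * d) ^ (2 * card U) * n powr (- real (card U) / m1 H) * card E"
  proof (intro mult_right_mono power_increasing)
    have "v \<le> (\<Sum>e\<in>U. card e)" unfolding v_def using card_UN_le[OF fU, of "\<lambda>e. e"] by simp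
    also have "\<dots> = 2 * card U" using c2 by simp
    finally show "v \<le> 2 * card U" .
    show "1 \<le> D * real d" using D d mult_mono[of 1 D 1 "real d"] by simp
  qed auto
  also have "n powr (- real (card U) / m1 H) = (n powr (- 1 / m1 H)) ^ card U"
    using n0 by (simp add: powr_realpow[symmetric] powr_powr)
  finally show ?thesis by (simp add: n_def power_mult power_mult_distrib)
qed

section \<open>Copies in the random subgraph\<close>

lemma prob_random_subset:
  assumes X: "finite X" and p: "0 \<le> p" "p \<le> 1"
  shows "measure_pmf.prob (Pi_pmf X False (\<lambda>_. bernoulli_pmf p)) {k. Q {e \<in> X. k e}}
    = binexp X p (\<lambda>W. if Q W then 1 else 0)"
proof -
  let ?M = "Pi_pmf X False (\<lambda>_. bernoulli_pmf p)"
  define ind :: "'a set \<Rightarrow> 'a \<Rightarrow> bool" where "ind W = (\<lambda>e. e \<in> W)" for W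
  have inj: "inj_on ind \<W>" for \<W> by (auto simp: inj_on_def ind_def fun_eq_iff)
  have "measure_pmf.prob ?M {k. Q {e \<in> X. k e}} = measure_pmf.prob ?M (ind ` {W \<in> Pow X. Q W})"
  proof (rule measure_prob_cong_0)
    fix k assume k: "k \<in> {k. Q {e \<in> X. k e}} - ind ` {W \<in> Pow X. Q W}"
    show "pmf ?M k = 0"
    proof (rule ccontr)
      assume "pmf ?M k \<noteq> 0"
      then have "k = ind {e \<in> X. k e}" using X by (auto simp: pmf_Pi ind_def fun_eq_iff split: if_splits)
      moreover have "{e \<in> X. k e} \<in> {W \<in> Pow X. Q W}" using k by auto
      ultimately show False using k by blast
    qed
  next
    fix k assume "k \<in> ind ` {W \<in> Pow X. Q W} - {k. Q {e \<in> X. k e}}"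
    then obtain W where W: "W \<subseteq> X" "Q W" "k = ind W" "\<not> Q {e \<in> X. k e}" by auto
    then have "{e \<in> X. k e} = W" by (auto simp: ind_def)
    then show "pmf ?M k = 0" using W by simp
  qed
  also have "\<dots> = (\<Sum>k\<in>ind ` {W \<in> Pow X. Q W}. pmf ?M k)"
    using X by (intro measure_measure_pmf_finite) auto
  also have "\<dots> = (\<Sum>W\<in>{W \<in> Pow X. Q W}. pmf ?M (ind W))"
    by (simp add: sum.reindex[OF inj])
  also have "\<dots> = (\<Sum>W\<in>{W \<in> Pow X. Q W}. p ^ card W * (1 - p) ^ card (X - W))"
  proof (rule sum.cong[OF refl])
    fix W assume "W \<in> {W \<in> Pow X. Q W}"
    then have W: "W \<subseteq> X" by simp
    have "pmf ?M (ind W) = (\<Prod>x\<in>X. if x \<in> W then p else 1 - p)"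
      using X W p by (subst pmf_Pi) (auto simp: ind_def intro!: prod.cong)
    also have "\<dots> = p ^ card W * (1 - p) ^ card (X - W)"
      using X W by (simp add: prod.If_cases Int_absorb1 Diff_eq)
    finally show "pmf ?M (ind W) = p ^ card W * (1 - p) ^ card (X - W)" .
  qed
  also have "\<dots> = binexp X p (\<lambda>W. if Q W then 1 else 0)"
    unfolding binexp_def using X by (subst sum.inter_filter) (auto intro!: sum.cong)
  finally show ?thesis .
qed

lemma prob_contains_copy_ge:
  assumes G: "simple_graph G" and p: "0 \<le> p" "p \<le> 1"
  shows "binexp (edges G) p (\<lambda>W. if \<exists>\<phi>\<in>embeddings H G. (`) \<phi> ` edges H \<subseteq> W then 1 else 0)
    \<le> measure_pmf.prob (random_subgraph G p) {K. contains_copy K H}"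
proof -
  let ?M = "Pi_pmf (edges G) False (\<lambda>_. bernoulli_pmf p)"
  have "binexp (edges G) p (\<lambda>W. if \<exists>\<phi>\<in>embeddings H G. (`) \<phi> ` edges H \<subseteq> W then 1 else 0)
     = measure_pmf.prob ?M {k. \<exists>\<phi>\<in>embeddings H G. (`) \<phi> ` edges H \<subseteq> {e \<in> edges G. k e}}"
    by (rule prob_random_subset[OF simple_graphD(2)[OF G] p, symmetric])
  also have "\<dots> \<le> measure_pmf.prob ?M {k. contains_copy (Graph (verts G) {e \<in> edges G. k e}) H}"
  proof (rule measure_pmf.finite_measure_mono)
    show "{k. \<exists>\<phi>\<in>embeddings H G. (`) \<phi> ` edges H \<subseteq> {e \<in> edges G. k e}}
       \<subseteq> {k. contains_copy (Graph (verts G) {e \<in> edges G. k e}) H}"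
    proof clarify
      fix k \<phi> assume \<phi>: "\<phi> \<in> embeddings H G" "(`) \<phi> ` edges H \<subseteq> {e \<in> edges G. k e}"
      show "contains_copy (Graph (verts G) {e \<in> edges G. k e}) H"
        unfolding contains_copy_def
        using \<phi> by (intro exI[of _ \<phi>]) (auto simp: embeddings_def bij_betw_def)
    qed
  qed simp
  also have "\<dots> = measure_pmf.prob (random_subgraph G p) {K. contains_copy K H}"
    by (simp add: random_subgraph_def vimage_def)
  finally show ?thesis .
qed

text \<open>
  The quantitative form of the theorem for a single pair of graphs. The sets to be hit are the images of
  the edge set of \<open>H\<close>; their size is at most \<open>d * n\<close>, so \<open>log 2 (d * n)\<close> halvings of the size suffice.
\<close>

lemma prob_contains_copy:
  fixes \<gamma> p :: real and d :: nat
  assumes \<gamma>: "\<gamma> > 0" and d: "d \<ge> 1" and n: "n \<ge> 2"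
    and H: "simple_graph H" "card (verts H) = n" "max_degree H \<le> d"
    and G: "simple_graph G" "card (verts G) = n"
      "real (min_degree G) \<ge> ((2 * real d - 1) / (2 * real d) + \<gamma>) * real n"
    and p: "0 \<le> p" "p \<le> 1"
    and large: "p \<ge> 256 * (3 * (log 2 (d * n) + 1) + 1) *
      (((exp 1 / (2 * d * \<gamma>)) powr (2 / (2 * d * \<gamma>)) * d)\<^sup>2 * m1_power n H)"
  shows "1 - 1 / sqrt (1 + log 2 n) \<le> measure_pmf.prob (random_subgraph G p) {K. contains_copy K H}"
proof -
  define c where "c = 2 * d * \<gamma>"
  define D where "D = (exp 1 / c) powr (2 / c)"
  define b where "b = (1 / (2 * d) - \<gamma>) * n"
  define E where "E = embeddings H G"
  define X where "X = edges G"
  have c0: "0 < c" using \<gamma> d by (simp add: c_def)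
  note fin = simple_graphD(1)[OF H(1)] simple_graphD(1)[OF G(1)]
  have degH: "degree H v \<le> d" if "v \<in> verts H" for v
  proof -
    have "degree H v \<le> max_degree H" unfolding max_degree_def using fin(1) that by (intro Max_ge) auto
    then show ?thesis using H(3) by linarith
  qed
  have non: "card (non_nbrs G w) \<le> b" if w: "w \<in> verts G" for w
  proof -
    have "min_degree G \<le> degree G w"
      unfolding min_degree_def using fin(2) w by (intro Min_le) auto
    moreover have "degree G w \<le> n"
      using card_nbrs[OF G(1), of w] card_mono[OF fin(2) simple_graphD(6)[OF G(1)], of w] G(2) by simp
    ultimately have "real (card (non_nbrs G w)) \<le> n - ((2 * real d - 1) / (2 * real d) + \<gamma>) * real n"
      using card_non_nbrs[OF G(1), of w] G(2,3) by simp
    also have "\<dots> = b" using d by (simp add: b_def field_simps)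
    finally show ?thesis .
  qed
  have cb: "real n - 2 * d * b = c * n" using d by (simp add: b_def c_def field_simps)
  have ne: "verts H \<noteq> {}" using n H(2) by auto
  have sw: "c * card (verts H) \<le> card (swaps E \<phi> x (verts H))" if "\<phi> \<in> E" "x \<in> verts H" for \<phi> x
  proof -
    have "bij_betw \<phi> (verts H) (verts G)" using that by (simp add: E_def embeddings_def)
    then have "c * card (verts H) \<le> card (good_partners H G \<phi> x)"
      using card_good_partners[OF H(1) degH G(1) non _ that(2), of \<phi>] cb H(2) by simp
    also have "\<dots> \<le> card (swaps E \<phi> x (verts H))"
      unfolding E_def of_nat_le_iff using that fin
      by (intro card_mono good_partners_subset_swaps) (auto simp: E_def)
    finally show ?thesis .
  qed
  have "0 < c * n" using c0 n by simp
  then have "2 * d * b < card (verts H)" using cb unfolding H(2) by linarith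
  then have E0: "E \<noteq> {}" unfolding E_def using G(2) H(2)
    by (intro embeddings_nonempty[OF H(1) degH G(1) non]) auto
  have EPi: "E \<subseteq> verts H \<rightarrow>\<^sub>E verts G" by (auto simp: E_def embeddings_def)
  have finE: "finite E" using EPi fin by (meson finite_PiE finite_subset)
  \<comment> \<open>A set of swap partners has at most \<open>n\<close> elements.\<close>
  have c1: "c \<le> 1"
  proof -
    obtain \<phi> x where "\<phi> \<in> E" "x \<in> verts H" using E0 ne by blast
    then have "c * card (verts H) \<le> card (swaps E \<phi> x (verts H))" by (rule sw)
    also have "\<dots> \<le> card (verts H)" unfolding of_nat_le_iff using fin by (intro card_mono) (auto simp: swaps_def)
    finally show ?thesis using n H(2) by simp
  qed
  have "c \<le> exp 1" using c1 one_le_exp_iff[of "1::real"] by linarith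
  then have D1: "1 \<le> D" unfolding D_def using c0 by (intro ge_one_powr_ge_zero) auto
  have spread: "card {\<phi> \<in> E. \<forall>x\<in>S. \<phi> x = y x} \<le> (D / card (verts H)) ^ card S * card E"
    if "S \<subseteq> verts H" for S y
    unfolding D_def
  proof (rule many_swaps_imp_vertex_spread[OF E0 EPi _ fin(1) ne fin(2) _ c0 c1 sw that])
    show "inj_on \<phi> (verts H)" if "\<phi> \<in> E" for \<phi> using that by (auto simp: E_def embeddings_def bij_betw_def)
  qed (use G H in auto)
  have log0: "0 \<le> log 2 n" using n by simp
  have low: "1 - 1 / sqrt (1 + log 2 n)
      \<le> binexp X p (\<lambda>W. if \<exists>\<phi>\<in>E. (`) \<phi> ` edges H \<subseteq> W then 1 else 0)"
  proof (cases "edges H = {}")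
    case True
    then have "binexp X p (\<lambda>W. if \<exists>\<phi>\<in>E. (`) \<phi> ` edges H \<subseteq> W then 1 else 0) = 1"
      using E0 binexp_const[OF simple_graphD(2)[OF G(1)], of p 1] by (simp add: X_def ex_in_conv)
    then show ?thesis using log0 by simp
  next
    case False
    then obtain e where e: "e \<in> edges H" by blast
    define k where "k = nat \<lceil>log 2 (d * n)\<rceil>"
    define q where "q = (D * d)\<^sup>2 * real n powr (- 1 / m1 H)"
    have m: "0 < m1 H"
    proof -
      have "subgraph (Graph e {e}) H"
        using simple_graphD(3,4)[OF H(1) e] e fin(1) by (auto simp: subgraph_def simple_graph_def intro: finite_subset)
      then have "d1 (Graph e {e}) \<le> m1 H"
        using simple_graphD(4)[OF H(1) e] by (intro d1_le_m1[OF H(1)]) auto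
      then show ?thesis using simple_graphD(4)[OF H(1) e] by (simp add: d1_def)
    qed
    have q0: "0 < q" using D1 d n by (simp add: q_def)
    have dn: "1 \<le> real d * real n" using d n mult_mono[of 1 "real d" 1 "real n"] by simp
    then have ldn: "0 \<le> log 2 (d * n)" by simp
    have k1: "log 2 (d * n) \<le> k" "k \<le> log 2 (d * n) + 1" using ldn by (auto simp: k_def)
    have "real n \<le> real d * real n" using d mult_right_mono[of 1 "real d" "real n"] by simp
    then have k2: "log 2 n \<le> k" using n k1(1) order_trans[OF log_mono[of 2 "real n" "real d * real n"]] by simp
    have k3: "d * n \<le> 2 ^ k"
    proof -
      have "real d * real n = 2 powr (log 2 (d * n))" using dn by simp
      also have "\<dots> \<le> 2 powr k" by (intro powr_mono k1) simp
      also have "\<dots> = 2 ^ k" by (simp add: powr_realpow)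
      finally have "real (d * n) \<le> real (2 ^ k)" by simp
      then show ?thesis by (simp only: of_nat_le_iff)
    qed
    have eH: "card (edges H) \<le> 2 ^ k"
    proof -
      have "edges H \<subseteq> (\<Union>v\<in>verts H. {e \<in> edges H. v \<in> e})"
      proof
        fix f assume f: "f \<in> edges H"
        then obtain v where "v \<in> f" using simple_graphD(4)[OF H(1) f] by fastforce
        then show "f \<in> (\<Union>v\<in>verts H. {e \<in> edges H. v \<in> e})"
          using simple_graphD(3)[OF H(1) f] f by blast
      qed
      then have "card (edges H) \<le> card (\<Union>v\<in>verts H. {e \<in> edges H. v \<in> e})"
        using fin(1) simple_graphD(2)[OF H(1)] by (intro card_mono) auto
      also have "\<dots> \<le> (\<Sum>v\<in>verts H. degree H v)" unfolding degree_def by (rule card_UN_le[OF fin(1)])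
      also have "\<dots> \<le> (\<Sum>v\<in>verts H. d)" by (intro sum_mono degH)
      also have "\<dots> \<le> 2 ^ k" using k3 H(2) by (simp add: mult.commute)
      finally show ?thesis .
    qed
    have "1 - 1 / sqrt (1 + log 2 n) \<le> 1 - 1 / sqrt (1 + real k)"
      using k2 log0 by (simp add: frac_le)
    also have "\<dots> \<le> binexp X p (\<lambda>W. if \<exists>\<phi>\<in>E. (`) \<phi> ` edges H \<subseteq> W then 1 else 0)"
    proof (rule spread_imp_likely[OF _ finE E0 _ _ q0 _ _ p(2)])
      show "finite X" using simple_graphD(2)[OF G(1)] by (simp add: X_def)
      show "(`) \<phi> ` edges H \<subseteq> X" if "\<phi> \<in> E" for \<phi> using that by (auto simp: E_def embeddings_def X_def)
      show "card ((`) \<phi> ` edges H) \<le> 2 ^ k" if "\<phi> \<in> E" for \<phi>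
        using card_image_le[OF simple_graphD(2)[OF H(1)], of "(`) \<phi>"] eH by linarith
      show "real (card {\<phi> \<in> E. U \<subseteq> (`) \<phi> ` edges H}) \<le> q ^ card U * real (card E)" if "U \<subseteq> X" for U
        using vertex_spread_imp_spread[OF H(1) degH d m ne G(1) D1 _ finE spread that[unfolded X_def]]
        by (simp add: E_def q_def H(2))
      have "256 * (3 * real k + 1) * q \<le> 256 * (3 * (log 2 (d * n) + 1) + 1) * q"
        using k1(2) q0 by (intro mult_right_mono) auto
      also have "\<dots> \<le> p" using large False by (simp add: q_def D_def c_def m1_power_def)
      finally show "256 * (3 * real k + 1) * q \<le> p" .
    qed
    finally show ?thesis .
  qed
  also have "\<dots> \<le> measure_pmf.prob (random_subgraph G p) {K. contains_copy K H}"
    unfolding X_def E_def by (rule prob_contains_copy_ge[OF G(1) p])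
  finally show ?thesis .
qed

theorem theorem1p3:
  fixes \<gamma> :: real and \<Delta> :: nat
  assumes "\<gamma> > 0" and "\<Delta> \<ge> 1"
  shows "\<exists>C::real. C > 0 \<and>
    (\<forall>(H :: nat \<Rightarrow> nat graph) (G :: nat \<Rightarrow> nat graph) (p :: nat \<Rightarrow> real).
      (\<forall>\<^sub>F n in sequentially.
         simple_graph (H n) \<and> card (verts (H n)) = n \<and> max_degree (H n) \<le> \<Delta> \<and>
         simple_graph (G n) \<and> card (verts (G n)) = n \<and>
         real (min_degree (G n)) \<ge> ((2 * real \<Delta> - 1) / (2 * real \<Delta>) + \<gamma>) * real n \<and>
         0 \<le> p n \<and> p n \<le> 1 \<and> p n \<ge> C * m1_power n (H n) * ln (real n)) \<longrightarrow>
      (\<lambda>n. measure_pmf.prob (random_subgraph (G n) (p n)) {K. contains_copy K (H n)})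
        \<longlonglongrightarrow> 1)"
proof -
  define A where "A = ((exp 1 / (2 * \<Delta> * \<gamma>)) powr (2 / (2 * \<Delta> * \<gamma>)) * \<Delta>)\<^sup>2"
  \<comment> \<open>The factor \<open>3 * k + 1\<close> of the spread theorem is at most \<open>B * ln n\<close>.\<close>
  define B where "B = (7 + 3 * log 2 \<Delta>) / ln 2"
  have "0 \<le> log 2 \<Delta>" using assms(2) by simp
  then have B0: "0 < B" by (simp add: B_def)
  have A0: "0 < A" using assms by (simp add: A_def)
  have B: "3 * (log 2 (\<Delta> * n) + 1) + 1 \<le> B * ln n" if n: "n \<ge> 2" for n :: nat
  proof -
    have ln2: "0 < ln (2::real)" by simp
    have "ln 2 \<le> ln (real n)" using n by simp
    then have 1: "1 \<le> ln n / ln 2" using ln2 by (simp only: le_divide_eq_1_pos)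
    have "ln (real \<Delta> * real n) = ln \<Delta> + ln n" by (subst ln_mult) (use assms(2) n in auto)
    then have "3 * (log 2 (\<Delta> * n) + 1) + 1 = (4 + 3 * log 2 \<Delta>) * 1 + 3 * (ln n / ln 2)"
      by (simp add: log_def add_divide_distrib)
    also have "\<dots> \<le> (4 + 3 * log 2 \<Delta>) * (ln n / ln 2) + 3 * (ln n / ln 2)"
      using 1 \<open>0 \<le> log 2 \<Delta>\<close> by (intro add_mono mult_left_mono) auto
    also have "\<dots> = B * ln n" by (simp add: B_def algebra_simps add_divide_distrib)
    finally show ?thesis .
  qed
  show ?thesis
  proof (intro exI[of _ "256 * B * A"] conjI allI impI)
    show "0 < 256 * B * A" using A0 B0 by simp
    fix H G :: "nat \<Rightarrow> nat graph" and p :: "nat \<Rightarrow> real"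
    assume ev: "\<forall>\<^sub>F n in sequentially.
         simple_graph (H n) \<and> card (verts (H n)) = n \<and> max_degree (H n) \<le> \<Delta> \<and>
         simple_graph (G n) \<and> card (verts (G n)) = n \<and>
         real (min_degree (G n)) \<ge> ((2 * real \<Delta> - 1) / (2 * real \<Delta>) + \<gamma>) * real n \<and>
         0 \<le> p n \<and> p n \<le> 1 \<and> p n \<ge> 256 * B * A * m1_power n (H n) * ln (real n)"
    let ?P = "\<lambda>n. measure_pmf.prob (random_subgraph (G n) (p n)) {K. contains_copy K (H n)}"
    have low: "\<forall>\<^sub>F n in sequentially. 1 - 1 / sqrt (1 + log 2 n) \<le> ?P n"
      using ev eventually_ge_at_top[of 2]
    proof eventually_elim
      case (elim n)
      have "256 * (3 * (log 2 (\<Delta> * n) + 1) + 1) * (A * m1_power n (H n))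
          \<le> 256 * (B * ln n) * (A * m1_power n (H n))"
        using B[OF elim(2)] A0 by (intro mult_right_mono mult_left_mono) (auto simp: m1_power_def)
      also have "\<dots> \<le> p n" using elim(1) by (simp add: mult_ac)
      finally show ?case
        using elim assms unfolding A_def by (intro prob_contains_copy[where \<gamma> = \<gamma> and d = \<Delta>]) auto
    qed
    have lim: "(\<lambda>n. 1 - 1 / sqrt (1 + log 2 (real n))) \<longlonglongrightarrow> 1" by real_asymp
    show "?P \<longlonglongrightarrow> 1"
      by (rule tendsto_sandwich[OF low _ lim tendsto_const]) simp
  qed
qed

end
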